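(* Let $0<p,q\le\infty$ and let $n\in\mathbb{N}$. (a) If $0<p\le q\le\infty$, then for all $k\in\mathbb{N}$, $$ e_k(id:\ell^n_p(\mathbb{C})\to\ell^n_q(\mathbb{C}))\sim \begin{cases} 1 & \text{if } 1\le k\le \log_2(2n),\\ \left(\frac{\log_2(1+2n/k)}{k}\right)^{\frac1p-\frac1q} & \text{if } \log_2(2n)\le k\le 2n,\\ 2^{-\frac{k-1}{2n}}\,n^{\frac1q-\frac1p} & \text{if } 2n\le k. \end{cases} $$ (b) If $0<q\le p\le\infty$, then for all $k\in\mathbb{N}$, $$ e_k(id:\ell^n_p(\mathbb{C})\to\ell^n_q(\mathbb{C}))\sim 2^{-\frac{k-1}{2n}}\,n^{\frac1q-\frac1p}. $$ The constants of equivalence may depend on $p$ and $q$ but are independent of $k$ and $n$.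
   Context: For $0<p\le\infty$, $\ell_p^n(\mathbb{C})$ denotes $\mathbb{C}^n$ with the (quasi-)norm $\|z\|_p=(\sum_{i=1}^n|z_i|^p)^{1/p}$ for $p<\infty$ and $\|z\|_\infty=\max_i|z_i|$. For a bounded linear operator $T:X\to Y$ between quasi-Banach spaces and $k\in\mathbb{N}$, the $k$-th (dyadic) entropy number is $e_k(T)=\inf\{r>0:\exists y_1,\dots,y_{2^{k-1}}\in Y \text{ with } T(B_X)\subset\bigcup_{j=1}^{2^{k-1}}(y_j+rB_Y)\}$, where $B_X,B_Y$ are the closed unit balls. The notation $a\sim b$ means there exist constants $0<c\le C<\infty$ (depending only on $p,q$) with $c\,b\le a\le C\,b$. *)

theory Defs
  imports "HOL-Analysis.Analysis"
begin

text \<open>Vectors of \<open>\<complex>^n\<close> are represented as functions \<open>nat \<Rightarrow> complex\<close>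
  vanishing outside \<open>{..<n}\<close>.  The exponent \<open>p\<close> ranges over \<open>(0,\<infinity>]\<close>
  and is modelled as an extended real.\<close>

definition cvec :: "nat \<Rightarrow> (nat \<Rightarrow> complex) set" where
  "cvec n = {z. \<forall>i\<ge>n. z i = 0}"

definition lp_norm :: "ereal \<Rightarrow> nat \<Rightarrow> (nat \<Rightarrow> complex) \<Rightarrow> real" where
  "lp_norm p n z =
     (if p = \<infinity> then (if n = 0 then 0 else Max ((\<lambda>i. cmod (z i)) ` {..<n}))
      else (\<Sum>i<n. cmod (z i) powr real_of_ereal p) powr (1 / real_of_ereal p))"

definition lp_ball :: "ereal \<Rightarrow> nat \<Rightarrow> (nat \<Rightarrow> complex) set" where
  "lp_ball p n = {z \<in> cvec n. lp_norm p n z \<le> 1}"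

definition entropy_id :: "ereal \<Rightarrow> ereal \<Rightarrow> nat \<Rightarrow> nat \<Rightarrow> real" where
  "entropy_id p q n k = Inf {r. r > 0 \<and> (\<exists>Y. finite Y \<and> Y \<subseteq> cvec n \<and> card Y \<le> 2 ^ (k - 1) \<and>
        (\<forall>x\<in>lp_ball p n. \<exists>y\<in>Y. lp_norm q n (x - y) \<le> r))}"

definition recip :: "ereal \<Rightarrow> real" where
  "recip p = (if p = \<infinity> then 0 else 1 / real_of_ereal p)"

end

theory Submission
  imports Defs
begin

text \<open>Everything is done by counting, without volumes.  For the lower bounds, a finite test set is
  covered by balls, and a nonnegative weight that is at least \<open>\<theta>\<close> on each ball and sums to at most
  \<open>K\<close> over the test set forces \<open>(number of balls) * K \<ge> \<theta> * (size of test set)\<close>.  A full grid in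
  \<open>n powr (- 1/p) B_\<infinity>\<close> gives the bound \<open>2 powr (- (k - 1) / (2 n)) * n powr (1/q - 1/p)\<close>; vectors with
  exactly one nonzero entry in each of \<open>m\<close> blocks of length \<open>n div m\<close> give \<open>m powr (1/q - 1/p)\<close> as long as
  \<open>k\<close> is at most of order \<open>m * log 2 (n / m)\<close>.

  For the upper bounds, \<open>x\<close> in the unit ball of \<open>\<ell>_p\<close> is rounded towards \<open>0\<close> to \<open>\<rho>\<close> times a vector of
  Gaussian integers; those are counted with an exponential generating function.  This settles
  \<open>q = \<infinity>\<close> for \<open>k \<le> 2 n\<close>; interpolating the error between \<open>\<ell>_p\<close> and \<open>\<ell>_\<infinity>\<close> gives \<open>p \<le> q\<close>, and
  subdividing the cubes obtained for \<open>k = 2 n\<close> gives \<open>k \<ge> 2 n\<close>.\<close>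

subsection \<open>Norms, covers and entropy numbers\<close>

lemma lp_norm_le_iff:
  assumes "0 < a" "0 \<le> r"
  shows "lp_norm (ereal a) n z \<le> r \<longleftrightarrow> (\<Sum>i<n. cmod (z i) powr a) \<le> r powr a"
proof -
  let ?S = "\<Sum>i<n. cmod (z i) powr a"
  have S: "?S \<ge> 0" by (simp add: sum_nonneg)
  have e: "lp_norm (ereal a) n z = ?S powr (1/a)" by (simp add: lp_norm_def)
  have "?S powr (1/a) \<le> r \<longleftrightarrow> ?S \<le> r powr a"
  proof
    assume "?S powr (1/a) \<le> r"
    then have "(?S powr (1/a)) powr a \<le> r powr a" using assms by (intro powr_mono2) auto
    then show "?S \<le> r powr a" using S assms by (simp add: powr_powr)
  next
    assume "?S \<le> r powr a"
    then have "?S powr (1/a) \<le> (r powr a) powr (1/a)" using S assms by (intro powr_mono2) auto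
    then show "?S powr (1/a) \<le> r" using assms by (simp add: powr_powr)
  qed
  then show ?thesis using e by simp
qed

lemma lp_norm_inf_le_iff:
  assumes "1 \<le> n"
  shows "lp_norm \<infinity> n z \<le> r \<longleftrightarrow> (\<forall>i<n. cmod (z i) \<le> r)"
proof -
  have ne: "{..<n} \<noteq> {}" using assms by (simp add: lessThan_empty_iff)
  have "lp_norm \<infinity> n z = Max ((\<lambda>i. cmod (z i)) ` {..<n})" using assms by (simp add: lp_norm_def)
  moreover have "Max ((\<lambda>i. cmod (z i)) ` {..<n}) \<le> r \<longleftrightarrow> (\<forall>a\<in>(\<lambda>i. cmod (z i)) ` {..<n}. a \<le> r)"
    using ne by (subst Max_le_iff) auto
  ultimately show ?thesis by auto
qed

lemma ereal_pos_cases: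
  assumes "(0::ereal) < p"
  obtains (inf) "p = \<infinity>" | (fin) a where "p = ereal a" "0 < a"
  using assms by (cases p) auto

lemma recip_simps [simp]: "recip \<infinity> = 0" "recip (ereal a) = 1 / a"
  by (auto simp: recip_def)

lemma recip_antimono:
  assumes "0 < p" "p \<le> q"
  shows "recip q \<le> recip p"
  using assms by (cases p; cases q) (auto simp: frac_le)

lemma lp_norm_le_of_coord:
  assumes "0 < q" "1 \<le> n" "0 \<le> r" "\<And>i. i < n \<Longrightarrow> cmod (z i) \<le> r"
  shows "lp_norm q n z \<le> real n powr recip q * r"
  using assms(1)
proof (cases rule: ereal_pos_cases)
  case inf
  then show ?thesis using assms by (simp add: lp_norm_inf_le_iff)
next
  case (fin a)
  have "(\<Sum>i<n. cmod (z i) powr a) \<le> (\<Sum>i<n. r powr a)"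
    using assms fin by (intro sum_mono powr_mono2) auto
  also have "\<dots> = (real n powr (1/a) * r) powr a"
    using assms fin by (simp add: powr_mult powr_powr)
  finally show ?thesis using fin assms by (simp add: lp_norm_le_iff)
qed

lemma lp_ball_coord:
  assumes "0 < p" "1 \<le> n" "x \<in> lp_ball p n" "i < n"
  shows "cmod (x i) \<le> 1"
  using assms(1)
proof (cases rule: ereal_pos_cases)
  case inf
  then show ?thesis using assms by (simp add: lp_norm_inf_le_iff lp_ball_def)
next
  case (fin a)
  have "cmod (x i) powr a \<le> (\<Sum>i<n. cmod (x i) powr a)"
    using assms by (intro member_le_sum) auto
  also have "\<dots> \<le> 1" using fin assms by (simp add: lp_ball_def lp_norm_le_iff)
  finally have "(cmod (x i) powr a) powr (1/a) \<le> 1 powr (1/a)"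
    using fin by (intro powr_mono2) auto
  then show ?thesis using fin by (simp add: powr_powr)
qed

definition covers :: "ereal \<Rightarrow> ereal \<Rightarrow> nat \<Rightarrow> (nat \<Rightarrow> complex) set \<Rightarrow> real \<Rightarrow> bool" where
  "covers p q n Y r \<longleftrightarrow> finite Y \<and> Y \<subseteq> cvec n \<and> (\<forall>x\<in>lp_ball p n. \<exists>y\<in>Y. lp_norm q n (x - y) \<le> r)"

lemma entropy_id_le:
  assumes "r > 0" "covers p q n Y r" "card Y \<le> 2 ^ (k - 1)"
  shows "entropy_id p q n k \<le> r"
  unfolding entropy_id_def
proof (rule cInf_lower)
  show "r \<in> {r. r > 0 \<and> (\<exists>Y. finite Y \<and> Y \<subseteq> cvec n \<and> card Y \<le> 2 ^ (k - 1) \<and>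
        (\<forall>x\<in>lp_ball p n. \<exists>y\<in>Y. lp_norm q n (x - y) \<le> r))}"
    using assms unfolding covers_def by auto
qed (intro bdd_belowI[of _ 0], auto)

text \<open>The single centre \<open>0\<close> is admissible for every \<open>k\<close>, because
  \<open>2 ^ (k - 1)\<close> is at least 1.\<close>

lemma entropy_id_le_trivial:
  assumes "r > 0" "\<And>x. x \<in> lp_ball p n \<Longrightarrow> lp_norm q n x \<le> r"
  shows "entropy_id p q n k \<le> r"
proof (rule entropy_id_le)
  have "x - (\<lambda>_. 0) = x" for x :: "nat \<Rightarrow> complex" by auto
  then show "covers p q n {\<lambda>_. 0} r"
    using assms unfolding covers_def by (auto simp: cvec_def)
qed (use assms in auto)

lemma entropy_id_ge:
  assumes "0 < p" "0 < q" "1 \<le> n"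
    and "\<And>r Y. r > 0 \<Longrightarrow> covers p q n Y r \<Longrightarrow> card Y \<le> 2 ^ (k - 1) \<Longrightarrow> c \<le> r"
  shows "c \<le> entropy_id p q n k"
  unfolding entropy_id_def
proof (rule cInf_greatest)
  \<comment> \<open>A lower bound passes to the \<open>Inf\<close> of a set of reals only if the set
    is nonempty. The centre \<open>0\<close> with this radius provides a member, since coordinates
    of points of the unit ball have modulus at most 1.\<close>
  let ?r = "real n powr recip q * 1"
  have "x - (\<lambda>_. 0) = x" for x :: "nat \<Rightarrow> complex" by auto
  then have "?r > 0 \<and> (\<exists>Y. finite Y \<and> Y \<subseteq> cvec n \<and> card Y \<le> 2 ^ (k - 1) \<and>
        (\<forall>x\<in>lp_ball p n. \<exists>y\<in>Y. lp_norm q n (x - y) \<le> ?r))"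
    using assms lp_norm_le_of_coord[OF assms(2,3), of 1] lp_ball_coord[OF assms(1,3)]
    by (intro conjI exI[of _ "{\<lambda>_. 0}"]) (auto simp: cvec_def)
  then show "{r. r > 0 \<and> (\<exists>Y. finite Y \<and> Y \<subseteq> cvec n \<and> card Y \<le> 2 ^ (k - 1) \<and>
        (\<forall>x\<in>lp_ball p n. \<exists>y\<in>Y. lp_norm q n (x - y) \<le> r))} \<noteq> {}"
    by blast
qed (use assms(4) in \<open>auto simp: covers_def\<close>)

subsection \<open>Lower bounds\<close>

text \<open>Double counting of \<open>f y w\<close> over all pairs: every \<open>w\<close>
  contributes at least \<theta> through one of the \<open>y\<close>, and every \<open>y\<close>
  contributes at most \<open>K\<close>. This takes the place of a comparison of volumes.\<close>

lemma weighted_cover_bound: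
  fixes f :: "'y \<Rightarrow> 'w \<Rightarrow> real"
  assumes "finite Y" "finite W" "\<And>y w. 0 \<le> f y w"
    and "\<And>w. w \<in> W \<Longrightarrow> \<exists>y\<in>Y. \<theta> \<le> f y w"
    and "\<And>y. y \<in> Y \<Longrightarrow> (\<Sum>w\<in>W. f y w) \<le> K"
  shows "real (card W) * \<theta> \<le> real (card Y) * K"
proof -
  have "real (card W) * \<theta> = (\<Sum>w\<in>W. \<theta>)" by simp
  also have "\<dots> \<le> (\<Sum>w\<in>W. \<Sum>y\<in>Y. f y w)"
  proof (rule sum_mono)
    fix w assume "w \<in> W"
    then obtain y where y: "y \<in> Y" "\<theta> \<le> f y w" using assms(4) by blast
    have "f y w \<le> (\<Sum>y\<in>Y. f y w)" using y assms by (intro member_le_sum) auto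
    then show "\<theta> \<le> (\<Sum>y\<in>Y. f y w)" using y by simp
  qed
  also have "\<dots> = (\<Sum>y\<in>Y. \<Sum>w\<in>W. f y w)" by (rule sum.swap)
  also have "\<dots> \<le> (\<Sum>y\<in>Y. K)" by (intro sum_mono assms)
  finally show ?thesis by simp
qed

section \<open>Logarithmic weights and sums over Gaussian integers\<close>

text \<open>For \<open>t > 1\<close> combine \<open>1 + t \<le> 2 * t\<close>,
  \<open>ln 2 < 1\<close> and \<open>ln u \<le> u\<close> at \<open>u = t powr a\<close>. The
  inequality serves both directions of the theorem: norms control logarithmic weights in the lower
  bound, and exponential sums are dominated by inverse fourth powers in the upper bound.\<close>

lemma ln_add_one_le_powr:
  fixes a t :: real
  assumes "0 < a" "0 \<le> t"
  shows "ln (1 + t) \<le> 1 + t powr a / a"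
proof (cases "t \<le> 1")
  case True
  have "ln (1 + t) \<le> t" using assms by (intro ln_add_one_self_le_self)
  moreover have "t powr a / a \<ge> 0" using assms by simp
  ultimately show ?thesis using True by linarith
next
  case False
  then have "ln (1 + t) \<le> ln (2 * t)" by (intro ln_mono) auto
  also have "\<dots> = ln 2 + ln t" using False by (simp add: ln_mult)
  also have "ln t = ln (t powr a) / a" using assms False by (simp add: ln_powr)
  also have "ln (t powr a) \<le> t powr a" using False by (intro ln_bound) auto
  finally show ?thesis using ln_2_less_1 assms by (simp add: divide_right_mono)
qed

lemma sum_inverse_squares_le: "(\<Sum>i<N. 1 / (1 + real i)\<^sup>2) \<le> 2"
proof -
  \<comment> \<open>The subtracted term strengthens the claim so that the induction
    telescopes.\<close>
  have "(\<Sum>i<Suc N. 1 / (1 + real i)\<^sup>2) \<le> 2 - 1 / (1 + real N)" for N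
  proof (induction N)
    case (Suc N)
    have "1 / (1 + real (Suc N))\<^sup>2 \<le> 1 / (1 + real N) - 1 / (1 + real (Suc N))"
      by (simp add: divide_simps power2_eq_square)
    then show ?case using Suc by simp
  qed simp
  from this[of N] have "(\<Sum>i<Suc N. 1 / (1 + real i)\<^sup>2) \<le> 2"
    by (rule order_trans) simp
  moreover have "(\<Sum>i<N. 1 / (1 + real i)\<^sup>2) \<le> (\<Sum>i<Suc N. 1 / (1 + real i)\<^sup>2)"
    by simp
  ultimately show ?thesis by linarith
qed

text \<open>The numbers \<open>g j\<close> are distinct naturals, so replacing \<open>h j\<close> by
  \<open>g j\<close> compares the sum with the series of inverse squares.\<close>

lemma sum_inverse_squares_inj_le:
  fixes g :: "'a \<Rightarrow> nat" and h :: "'a \<Rightarrow> real"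
  assumes "finite J" "inj_on g J" "\<And>j. j \<in> J \<Longrightarrow> real (g j) \<le> h j"
  shows "(\<Sum>j\<in>J. 1 / (1 + h j)\<^sup>2) \<le> 2"
proof -
  have "(\<Sum>j\<in>J. 1 / (1 + h j)\<^sup>2) \<le> (\<Sum>j\<in>J. 1 / (1 + real (g j))\<^sup>2)"
    using assms(3) by (intro sum_mono divide_left_mono power_mono) (auto intro!: mult_pos_pos, smt (verit) of_nat_0_le_iff zero_less_power)
  also have "\<dots> = (\<Sum>i\<in>g ` J. 1 / (1 + real i)\<^sup>2)"
    using assms(2) by (simp add: sum.reindex)
  also have "\<dots> \<le> (\<Sum>i<Suc (Max (g ` J)). 1 / (1 + real i)\<^sup>2)"
    using assms(1) by (intro sum_mono2) (auto simp: less_Suc_eq_le)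
  also have "\<dots> \<le> 2" by (rule sum_inverse_squares_le)
  finally show ?thesis .
qed

text \<open>The integers on each side of \<open>y\<close> are numbered injectively by naturals not
  exceeding their distance to \<open>y\<close>, and each side contributes at most 2. The bound
  depends neither on \<open>y\<close> nor on \<open>J\<close>.\<close>

lemma sum_int_inverse_squares_le:
  fixes J :: "int set" and y :: real
  assumes "finite J"
  shows "(\<Sum>j\<in>J. 1 / (1 + \<bar>of_int j - y\<bar>)\<^sup>2) \<le> 4"
proof -
  let ?f = "\<lambda>j::int. 1 / (1 + \<bar>of_int j - y\<bar>)\<^sup>2"
  define A where "A = {j\<in>J. j \<le> \<lfloor>y\<rfloor>}"
  define B where "B = {j\<in>J. \<lfloor>y\<rfloor> < j}"
  have "sum ?f J = sum ?f A + sum ?f B"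
    using assms by (subst sum.union_disjoint[symmetric]) (auto simp: A_def B_def intro!: sum.cong)
  moreover have "sum ?f A \<le> 2"
    by (rule sum_inverse_squares_inj_le[where g = "\<lambda>j. nat (\<lfloor>y\<rfloor> - j)"])
       (use assms in \<open>auto simp: A_def inj_on_def of_nat_nat\<close>, linarith)
  \<comment> \<open>The shift by 1 is forced, because \<open>y\<close> may lie just below
    \<open>\<lfloor>y\<rfloor> + 1\<close>.\<close>
  moreover have "sum ?f B \<le> 2"
    by (rule sum_inverse_squares_inj_le[where g = "\<lambda>j. nat (j - \<lfloor>y\<rfloor> - 1)"])
       (use assms in \<open>auto simp: B_def inj_on_def of_nat_nat\<close>, linarith)
  ultimately show ?thesis by linarith
qed

definition gauss_int :: "int set \<Rightarrow> complex set" where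
  "gauss_int J = (\<lambda>(a,b). Complex (of_int a) (of_int b)) ` (J \<times> J)"

lemma inj_gauss: "inj_on (\<lambda>(a::int,b::int). Complex (of_int a) (of_int b)) X"
  by (auto simp: inj_on_def)

lemma finite_gauss_int [simp]: "finite J \<Longrightarrow> finite (gauss_int J)"
  by (simp add: gauss_int_def)

lemma card_gauss_int: "card (gauss_int J) = card J ^ 2"
  unfolding gauss_int_def by (subst card_image[OF inj_gauss]) (simp add: card_cartesian_product power2_eq_square)

text \<open>The quantity \<open>1 + cmod (z - u)\<close> dominates the same expression for the real
  and for the imaginary part, so its fourth power dominates the product of two squares. The sum then
  splits into two sums over integers, each at most 4.\<close>

lemma sum_gauss_int_le:
  assumes "finite J"
  shows "(\<Sum>z\<in>gauss_int J. 1 / (1 + cmod (z - u)) ^ 4) \<le> 16"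
proof -
  let ?f = "\<lambda>y j::int. 1 / (1 + \<bar>of_int j - y\<bar>)\<^sup>2 :: real"
  have "(\<Sum>z\<in>gauss_int J. 1 / (1 + cmod (z - u)) ^ 4)
      = (\<Sum>(a,b)\<in>J\<times>J. 1 / (1 + cmod (Complex (of_int a) (of_int b) - u)) ^ 4)"
    unfolding gauss_int_def by (subst sum.reindex[OF inj_gauss]) (simp add: case_prod_unfold o_def)
  also have "\<dots> \<le> (\<Sum>(a,b)\<in>J\<times>J. ?f (Re u) a * ?f (Im u) b)"
  proof (rule sum_mono, clarify)
    fix a b :: int
    let ?t = "cmod (Complex (of_int a) (of_int b) - u)"
    have "\<bar>of_int a - Re u\<bar> \<le> ?t" "\<bar>of_int b - Im u\<bar> \<le> ?t"
      using abs_Re_le_cmod[of "Complex (of_int a) (of_int b) - u"]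
        abs_Im_le_cmod[of "Complex (of_int a) (of_int b) - u"] by auto
    then have "(1 + \<bar>of_int a - Re u\<bar>)\<^sup>2 * (1 + \<bar>of_int b - Im u\<bar>)\<^sup>2 \<le> (1 + ?t)\<^sup>2 * (1 + ?t)\<^sup>2"
      by (intro mult_mono power_mono) auto
    also have "\<dots> = (1 + ?t) ^ 4" by (simp add: power_add[symmetric])
    finally have "1 / (1 + ?t) ^ 4 \<le> 1 / ((1 + \<bar>of_int a - Re u\<bar>)\<^sup>2 * (1 + \<bar>of_int b - Im u\<bar>)\<^sup>2)"
      by (intro divide_left_mono) (auto intro!: mult_pos_pos zero_less_power add_pos_nonneg)
    then show "1 / (1 + ?t) ^ 4 \<le> ?f (Re u) a * ?f (Im u) b" by simp
  qed
  also have "\<dots> = sum (?f (Re u)) J * sum (?f (Im u)) J"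
    by (simp add: sum_product sum.cartesian_product)
  also have "\<dots> \<le> 4 * 4"
    using sum_int_inverse_squares_le[OF assms] by (intro mult_mono) (auto intro!: sum_nonneg)
  finally show ?thesis by simp
qed

section \<open>Lower bound from the full grid\<close>

lemma lp_norm_scale_le:
  assumes "0 < q" "1 \<le> n" "0 \<le> r" "0 < c" "lp_norm q n z \<le> r"
  shows "lp_norm q n (\<lambda>i. complex_of_real c * z i) \<le> c * r"
  using assms(1)
proof (cases rule: ereal_pos_cases)
  case inf
  then show ?thesis using assms by (simp add: lp_norm_inf_le_iff norm_mult)
next
  case (fin a)
  have "(\<Sum>i<n. cmod (complex_of_real c * z i) powr a) = c powr a * (\<Sum>i<n. cmod (z i) powr a)"
    using assms by (simp add: norm_mult powr_mult sum_distrib_left)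
  also have "\<dots> \<le> c powr a * r powr a"
    using assms fin by (intro mult_left_mono) (auto simp: lp_norm_le_iff)
  also have "\<dots> = (c * r) powr a" using assms by (simp add: powr_mult)
  finally show ?thesis using assms fin by (simp add: lp_norm_le_iff)
qed

text \<open>For finite \<open>q\<close> the assumption on \<open>v\<close> says that the mean of the
  \<open>q\<close>-th powers of the moduli is at most 1, and \<open>ln_add_one_le_powr\<close> turns
  this into a bound for the mean of the logarithms. For \<open>q = \<infinity>\<close> all moduli
  are at most 1. The constant \<open>B\<close> depends on \<open>q\<close> only.\<close>

lemma sum_ln_le_of_lp_norm:
  assumes "0 < q"
  obtains B where "0 \<le> B" "\<And>n v. \<lbrakk>1 \<le> n; lp_norm q n v \<le> real n powr recip q\<rbrakk>
    \<Longrightarrow> (\<Sum>i<n. ln (1 + cmod (v i))) \<le> B * real n"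
  using assms
proof (cases rule: ereal_pos_cases)
  case inf
  have "(\<Sum>i<n. ln (1 + cmod (v i))) \<le> 1 * real n"
    if "1 \<le> n" "lp_norm q n v \<le> real n powr recip q" for n v
  proof -
    have "(\<Sum>i<n. ln (1 + cmod (v i))) \<le> (\<Sum>i<n. 1)"
    proof (rule sum_mono)
      fix i assume "i \<in> {..<n}"
      then have "cmod (v i) \<le> 1" using that inf by (auto simp: lp_norm_inf_le_iff)
      then show "ln (1 + cmod (v i)) \<le> 1"
        using ln_add_one_self_le_self[of "cmod (v i)"] by simp
    qed
    then show ?thesis by simp
  qed
  then show ?thesis using that[of 1] by simp
next
  case (fin a)
  have "(\<Sum>i<n. ln (1 + cmod (v i))) \<le> (1 + 1/a) * real n"
    if "1 \<le> n" "lp_norm q n v \<le> real n powr recip q" for n v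
  proof -
    have "(\<Sum>i<n. cmod (v i) powr a) \<le> real n"
      using that fin by (simp add: lp_norm_le_iff powr_powr)
    moreover have "(\<Sum>i<n. ln (1 + cmod (v i))) \<le> (\<Sum>i<n. 1 + cmod (v i) powr a / a)"
      using fin by (intro sum_mono ln_add_one_le_powr) auto
    moreover have "\<dots> = real n + (\<Sum>i<n. cmod (v i) powr a) / a"
      by (simp add: sum.distrib sum_divide_distrib)
    ultimately have "(\<Sum>i<n. ln (1 + cmod (v i))) \<le> real n + real n / a"
      using fin(2) by (smt (verit) divide_right_mono)
    then show ?thesis by (simp add: algebra_simps)
  qed
  then show ?thesis using that[of "1 + 1/a"] fin by simp
qed

text \<open>The weight of a grid vector \<open>a\<close> relative to the centre \<open>u\<close> is \<open>\<Prod>i. (1 + \<bar>a i - u i\<bar>)\<^sup>-\<^sup>4\<close>; it is at least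
  \<open>exp (- 4 B n)\<close> on the ball of radius \<open>n powr (1/q)\<close> and sums to at most \<open>16 ^ n\<close>.\<close>

lemma cover_radius_ge_aux:
  fixes m :: nat
  assumes "0 < p" "0 < q" "1 \<le> n" "0 < r" "covers p q n Y r" "1 \<le> m"
    and B: "\<And>v. lp_norm q n v \<le> real n powr recip q \<Longrightarrow> (\<Sum>i<n. ln (1 + cmod (v i))) \<le> B * real n"
    and big: "real (card Y) * 16 ^ n < real m ^ (2 * n) * exp (- (4 * B * real n))"
  shows "real n powr (recip q - recip p) / (2 * real m) \<le> r"
proof (rule ccontr)
  assume "\<not> ?thesis"
  then have r: "r < real n powr (recip q - recip p) / (2 * real m)" by simp
  \<comment> \<open>The mesh of the grid. Grid entries have modulus at most \<open>2 * m\<close>, so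
    scaling by \<open>h\<close> makes every coordinate at most \<open>n powr (- recip p)\<close> and
    puts the vector into the unit ball.\<close>
  define h where "h = real n powr (- recip p) / (2 * real m)"
  have h: "h > 0" using assms by (simp add: h_def)
  define G where "G = gauss_int {0..<int m}"
  define W where "W = (\<Pi>\<^sub>E i\<in>{..<n}. G)"
  define x where "x w = (\<lambda>i. if i < n then complex_of_real h * w i else 0)" for w :: "nat \<Rightarrow> complex"
  define f where "f y w = (\<Prod>i<n. 1 / (1 + cmod (w i - y i / complex_of_real h)) ^ 4)"
    for y w :: "nat \<Rightarrow> complex"
  have finG: "finite G" by (simp add: G_def)
  have cardG: "card G = m\<^sup>2" by (simp add: G_def card_gauss_int)
  have "real (card W) * exp (- (4 * B * real n)) \<le> real (card Y) * 16 ^ n"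
  proof (rule weighted_cover_bound[where f = f])
    show "finite Y" using assms by (simp add: covers_def)
    show "finite W" using finG by (simp add: W_def finite_PiE)
    show "0 \<le> f y w" for y w by (simp add: f_def prod_nonneg)
    show "\<exists>y\<in>Y. exp (- (4 * B * real n)) \<le> f y w" if w: "w \<in> W" for w
    proof -
      have "lp_norm p n (x w) \<le> real n powr recip p * (real n powr (- recip p))"
      proof (rule lp_norm_le_of_coord)
        fix i assume i: "i < n"
        then have "w i \<in> G" using w by (auto simp: W_def)
        then have "cmod (w i) \<le> 2 * real m"
        proof -
          from \<open>w i \<in> G\<close> obtain a b where ab: "w i = Complex (of_int a) (of_int b)"
            "0 \<le> a" "a < int m" "0 \<le> b" "b < int m" by (auto simp: G_def gauss_int_def)
          have "cmod (w i) \<le> \<bar>Re (w i)\<bar> + \<bar>Im (w i)\<bar>" by (rule cmod_le)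
          also have "\<dots> \<le> 2 * real m" using ab by simp
          finally show ?thesis .
        qed
        then have "h * cmod (w i) \<le> h * (2 * real m)" using h by simp
        also have "\<dots> = real n powr (- recip p)" using assms by (simp add: h_def)
        finally show "cmod (x w i) \<le> real n powr (- recip p)"
          using i h by (simp add: x_def norm_mult)
      qed (use assms in auto)
      then have "lp_norm p n (x w) \<le> 1" using assms by (simp add: powr_minus)
      then have "x w \<in> lp_ball p n" by (simp add: lp_ball_def cvec_def x_def)
      then obtain y where y: "y \<in> Y" "lp_norm q n (x w - y) \<le> r"
        using assms by (auto simp: covers_def)
      \<comment> \<open>Measured in units of the mesh, the radius \<open>r\<close> is at most
        \<open>n powr recip q\<close>, which is the normalisation required by
        \<open>B\<close>.\<close>
      define v where "v = (\<lambda>i. complex_of_real (1/h) * (x w - y) i)"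
      have "lp_norm q n v \<le> (1/h) * r"
        unfolding v_def using assms h by (intro lp_norm_scale_le y(2)) auto
      also have "\<dots> \<le> (1/h) * (real n powr (recip q - recip p) / (2 * real m))"
        using h r by (intro mult_left_mono) auto
      also have "\<dots> = real n powr recip q"
        using assms by (simp add: h_def powr_diff powr_minus field_simps)
      finally have "(\<Sum>i<n. ln (1 + cmod (v i))) \<le> B * real n" by (rule B)
      moreover have "v i = w i - y i / complex_of_real h" if "i < n" for i
        using that h by (simp add: v_def x_def field_simps)
      ultimately have le: "(\<Sum>i<n. ln (1 + cmod (w i - y i / complex_of_real h))) \<le> B * real n"
        by simp
      have "f y w = (\<Prod>i<n. exp (- 4 * ln (1 + cmod (w i - y i / complex_of_real h))))"
        unfolding f_def
      proof (rule prod.cong[OF refl])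
        fix i
        let ?t = "1 + cmod (w i - y i / complex_of_real h)"
        have t: "?t > 0" by (smt (verit) norm_ge_zero)
        have "exp (- 4 * ln ?t) = inverse (exp (4 * ln ?t))" by (simp add: exp_minus)
        also have "exp (4 * ln ?t) = exp (ln ?t) ^ 4" by (simp add: exp_of_nat_mult[of 4, simplified])
        finally show "1 / ?t ^ 4 = exp (- 4 * ln ?t)" using t by (simp add: divide_inverse)
      qed
      also have "\<dots> = exp (\<Sum>i<n. - 4 * ln (1 + cmod (w i - y i / complex_of_real h)))"
        by (simp add: exp_sum)
      also have "(\<Sum>i<n. - 4 * ln (1 + cmod (w i - y i / complex_of_real h)))
        = - 4 * (\<Sum>i<n. ln (1 + cmod (w i - y i / complex_of_real h)))"
        by (simp only: sum_distrib_left)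
      finally have "exp (- (4 * B * real n)) \<le> f y w" using le by simp
      then show ?thesis using y by blast
    qed
    show "(\<Sum>w\<in>W. f y w) \<le> 16 ^ n" for y
    proof -
      have "(\<Sum>w\<in>W. f y w) = (\<Prod>i<n. \<Sum>z\<in>G. 1 / (1 + cmod (z - y i / complex_of_real h)) ^ 4)"
        unfolding W_def f_def using finG by (subst prod_sum_PiE) auto
      also have "\<dots> \<le> (\<Prod>i<n. 16)"
        unfolding G_def by (intro prod_mono conjI sum_nonneg sum_gauss_int_le) auto
      finally show ?thesis by simp
    qed
  qed
  moreover have "real (card W) = real m ^ (2 * n)"
    by (simp add: W_def card_PiE cardG power_mult)
  ultimately show False using big by simp
qed

text \<open>With \<open>m\<close> grid points per real direction, \<open>m\<close> of order
  \<open>2 powr ((k - 1) / (2 * n))\<close>, the \<open>m ^ (2 * n)\<close> grid vectors are too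
  many for \<open>2 ^ (k - 1)\<close> centres. The bound serves both parts of the theorem.\<close>

lemma entropy_lower_volume:
  assumes "0 < p" "0 < q"
  obtains c where "0 < c" "\<And>n k. \<lbrakk>1 \<le> n; 1 \<le> k\<rbrakk> \<Longrightarrow>
    c * (2 powr (- (real k - 1) / (2 * real n)) * real n powr (recip q - recip p)) \<le> entropy_id p q n k"
proof -
  obtain B where B: "0 \<le> B" "\<And>n v. \<lbrakk>1 \<le> n; lp_norm q n v \<le> real n powr recip q\<rbrakk>
    \<Longrightarrow> (\<Sum>i<n. ln (1 + cmod (v i))) \<le> B * real n"
    by (rule sum_ln_le_of_lp_norm[OF assms(2)]) blast
  define E where "E = exp (2 * B)"
  have E: "E \<ge> 1" using B by (simp add: E_def)
  show thesis
  proof (rule that[of "1 / (10 * E)"])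
    show "1 / (10 * E) > 0" using E by simp
    fix n k :: nat assume nk: "1 \<le> n" "1 \<le> k"
    define M where "M = 2 powr ((real k - 1) / (2 * real n))"
    have M: "M \<ge> 1" using nk by (simp add: M_def ge_one_powr_ge_zero)
    have Mn: "M ^ (2 * n) = 2 ^ (k - 1)"
    proof -
      have "M ^ (2 * n) = M powr real (2 * n)" using M by (subst powr_realpow) auto
      also have "\<dots> = 2 powr (real (k - 1))" using nk by (simp add: M_def powr_powr of_nat_diff)
      finally show ?thesis by (simp add: powr_realpow)
    qed
    have En: "E ^ (2 * n) = exp (4 * B * real n)"
      unfolding E_def by (simp add: exp_of_nat_mult[symmetric] algebra_simps)
    \<comment> \<open>In \<open>(4 * E * M) ^ (2 * n)\<close> the three factors pay for
      \<open>16 ^ n\<close>, for \<open>exp (4 * B * n)\<close> and for the number of centres.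
      \<open>Suc\<close> makes the comparison strict; \<open>E * M \<ge> 1\<close> absorbs the
      rounding into \<open>m \<le> 5 * E * M\<close>, whence the constant
      \<open>1 / (10 * E)\<close>.\<close>
    define m where "m = Suc (nat \<lfloor>4 * E * M\<rfloor>)"
    have EM: "1 \<le> E * M" using E M by (metis mult_mono mult_1 order_trans zero_le_one)
    have m: "real m > 4 * E * M" "real m \<le> 5 * E * M"
      using EM unfolding m_def by linarith+
    have invM: "2 powr (- (real k - 1) / (2 * real n)) = 1 / M"
      unfolding M_def by (simp only: powr_minus_divide[symmetric] minus_divide_left)
    have "1 / (10 * E) * (2 powr (- (real k - 1) / (2 * real n)) * real n powr (recip q - recip p))
       = real n powr (recip q - recip p) / (10 * E * M)"
      unfolding invM by simp
    also have "\<dots> \<le> real n powr (recip q - recip p) / (2 * real m)"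
      using m M E by (intro divide_left_mono) auto
    also have "\<dots> \<le> entropy_id p q n k"
    proof (rule entropy_id_ge[OF assms nk(1)])
      fix r Y assume "r > 0" and cov: "covers p q n Y r" and card: "card Y \<le> 2 ^ (k - 1)"
      show "real n powr (recip q - recip p) / (2 * real m) \<le> r"
      proof (rule cover_radius_ge_aux[OF assms nk(1) \<open>r > 0\<close> cov])
        show "1 \<le> m" by (simp add: m_def)
        have "real (card Y) \<le> 2 ^ (k - 1)" using card by (metis of_nat_le_iff of_nat_numeral of_nat_power)
        then have "real (card Y) * 16 ^ n \<le> M ^ (2 * n) * 4 ^ (2 * n)"
          unfolding Mn by (simp add: power_mult)
        also have "\<dots> = (4 * E * M) ^ (2 * n) * exp (- (4 * B * real n))"
          by (simp add: power_mult_distrib En exp_minus)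
        also have "\<dots> < real m ^ (2 * n) * exp (- (4 * B * real n))"
          using m nk E M by (intro mult_strict_right_mono power_strict_mono) auto
        finally show "real (card Y) * 16 ^ n < real m ^ (2 * n) * exp (- (4 * B * real n))" .
      qed (rule B(2)[OF nk(1)])
    qed
    finally show "1 / (10 * E) * (2 powr (- (real k - 1) / (2 * real n)) * real n powr (recip q - recip p))
      \<le> entropy_id p q n k" .
  qed
qed

section \<open>Lower bound from vectors with one entry per block\<close>

text \<open>Chebyshev's inequality for finite \<open>q\<close>: every index in \<open>I\<close>
  contributes at least the \<open>q\<close>-th power of \<open>h / 2\<close> to the
  \<open>q\<close>-th power of the norm. For \<open>q = \<infinity>\<close> the set \<open>I\<close>
  is empty.\<close>

lemma few_large_coords:
  assumes "0 < q"
  obtains c where "0 < c" "\<And>n m h v I. \<lbrakk>1 \<le> n; 1 \<le> m; 0 < h; lp_norm q n v \<le> c * h * real m powr recip q;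
      I \<subseteq> {..<n}; \<And>i. i \<in> I \<Longrightarrow> h / 2 \<le> cmod (v i)\<rbrakk> \<Longrightarrow> 2 * card I \<le> m"
  using assms
proof (cases rule: ereal_pos_cases)
  case inf
  have "2 * card I \<le> m"
    if "1 \<le> n" "1 \<le> m" "0 < h" "lp_norm q n v \<le> 1/4 * h * real m powr recip q"
      "I \<subseteq> {..<n}" "\<And>i. i \<in> I \<Longrightarrow> h / 2 \<le> cmod (v i)" for n m h v I
  proof -
    have "I = {}"
    proof (rule ccontr)
      assume "I \<noteq> {}"
      then obtain i where "i \<in> I" by blast
      moreover have "\<forall>i<n. cmod (v i) \<le> 1/4 * h"
        using that(2,4) inf by (subst lp_norm_inf_le_iff[OF that(1), symmetric]) simp
      ultimately show False using that by fastforce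
    qed
    then show ?thesis by simp
  qed
  then show ?thesis by (rule that[of "1/4", rotated]) auto
next
  case (fin a)
  \<comment> \<open>The factor \<open>1/2\<close> matches the threshold \<open>h / 2\<close>; the
    other factor has \<open>a\<close>-th power \<open>1/2\<close> and yields the fraction
    \<open>m / 2\<close>.\<close>
  define c where "c = (1/2) * 2 powr (- 1 / a)"
  have c0: "0 < c" by (simp add: c_def)
  have ca: "c powr a = (1/2) powr a / 2"
  proof -
    have "c powr a = (1/2) powr a * (2 powr (- 1 / a)) powr a" by (simp only: c_def powr_mult)
    also have "(2 powr (- 1 / a)) powr a = (2::real) powr (- 1)" unfolding powr_powr using fin by simp
    finally show ?thesis by (simp add: powr_minus)
  qed
  have "2 * card I \<le> m"
    if *: "1 \<le> n" "1 \<le> m" "0 < h" "lp_norm q n v \<le> c * h * real m powr recip q"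
      "I \<subseteq> {..<n}" "\<And>i. i \<in> I \<Longrightarrow> h / 2 \<le> cmod (v i)" for n m h v I
  proof -
    have "real (card I) * (h / 2) powr a = (\<Sum>i\<in>I. (h / 2) powr a)" by simp
    also have "\<dots> \<le> (\<Sum>i\<in>I. cmod (v i) powr a)"
      using * fin by (intro sum_mono powr_mono2) auto
    also have "\<dots> \<le> (\<Sum>i<n. cmod (v i) powr a)"
      using * by (intro sum_mono2) auto
    also have "\<dots> \<le> (c * h * real m powr (1/a)) powr a"
      using * fin by (subst lp_norm_le_iff[symmetric]) (auto simp: c_def)
    also have "\<dots> = (c powr a) * (h powr a) * real m"
      using * fin by (simp add: powr_mult powr_powr)
    also have "\<dots> = (h / 2) powr a * (real m / 2)"
      using * unfolding ca by (simp add: powr_divide)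
    finally have "(h / 2) powr a * real (card I) \<le> (h / 2) powr a * (real m / 2)"
      by (simp add: mult.commute)
    then have "real (card I) \<le> real m / 2"
      using * by (subst (asm) mult_le_cancel_left_pos) auto
    then show ?thesis by linarith
  qed
  then show ?thesis by (rule that[OF c0])
qed

text \<open>The coordinates are cut into \<open>m\<close> blocks of length \<open>b\<close>; a word in \<open>{..<b} ^ m\<close> gives a vector with
  one nonzero entry per block.  Within each block, every \<open>y\<close> is close to at most one of these choices,
  namely the position \<open>g y j\<close> of its largest entry.\<close>

lemma entropy_lower_blocks:
  assumes "0 < p" "0 < q"
  obtains c where "0 < c" "\<And>n k m b. \<lbrakk>1 \<le> k; 1 \<le> m; 16 \<le> b; m * b \<le> n; 4 * real k \<le> real m * log 2 (real b)\<rbrakk>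
    \<Longrightarrow> c * real m powr (recip q - recip p) \<le> entropy_id p q n k"
proof -
  obtain c where c: "0 < c" "\<And>n m h v I. \<lbrakk>1 \<le> n; 1 \<le> m; 0 < h; lp_norm q n v \<le> c * h * real m powr recip q;
      I \<subseteq> {..<n}; \<And>i. i \<in> I \<Longrightarrow> h / 2 \<le> cmod (v i)\<rbrakk> \<Longrightarrow> 2 * card I \<le> m"
    by (rule few_large_coords[OF assms(2)]) blast
  show thesis
  proof (rule that[OF c(1)])
    fix n k m b :: nat
    assume km: "1 \<le> k" "1 \<le> m" "16 \<le> b" "m * b \<le> n" "4 * real k \<le> real m * log 2 (real b)"
    have n: "1 \<le> n" using km by (metis One_nat_def Suc_leI le_trans nat_0_less_mult_iff not_numeral_le_zero gr0I zero_less_one less_le_trans)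
    have coord: "j * b + l < n" if "j < m" "l < b" for j l
    proof -
      have "j * b + l < Suc j * b" using that by simp
      also have "\<dots> \<le> m * b" using that by (intro mult_right_mono) auto
      finally show ?thesis using km by linarith
    qed
    \<comment> \<open>A vector with exactly \<open>m\<close> nonzero entries, all of this modulus,
      has \<open>p\<close>-norm 1.\<close>
    define h where "h = real m powr (- recip p)"
    have h: "h > 0" using km by (simp add: h_def)
    define W where "W = (\<Pi>\<^sub>E j\<in>{..<m}. {..<b})"
    define x where "x w = (\<lambda>i. if i < m * b \<and> w (i div b) = i mod b then complex_of_real h else 0)"
      for w :: "nat \<Rightarrow> nat"
    have x_block: "x w (j * b + l) = (if w j = l then complex_of_real h else 0)"
      if "j < m" "l < b" for w j l
    proof -
      have "j * b + l < Suc j * b" using that by simp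
      also have "\<dots> \<le> m * b" using that by (intro mult_right_mono) auto
      finally show ?thesis using that by (simp add: x_def)
    qed
    have "\<exists>g. \<forall>y j. g y j < b \<and> (\<forall>l<b. cmod (y (j * b + l)) \<le> cmod (y (j * b + g y j)))"
    proof -
      have "\<exists>t<b. \<forall>l<b. cmod (y (j * b + l)) \<le> cmod (y (j * b + t))" for y :: "nat \<Rightarrow> complex" and j
      proof -
        have fin: "finite ((\<lambda>l. cmod (y (j * b + l))) ` {..<b})" by simp
        have "(\<lambda>l. cmod (y (j * b + l))) ` {..<b} \<noteq> {}" using km by (auto simp: lessThan_empty_iff)
        from Max_in[OF fin this] obtain t where "t < b"
          "Max ((\<lambda>l. cmod (y (j * b + l))) ` {..<b}) = cmod (y (j * b + t))" by auto
        then show ?thesis using Max_ge[OF fin] by (metis imageI lessThan_iff)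
      qed
      then show ?thesis by metis
    qed
    then obtain g :: "(nat \<Rightarrow> complex) \<Rightarrow> nat \<Rightarrow> nat" where
      g: "\<And>y j. g y j < b" "\<And>y j l. l < b \<Longrightarrow> cmod (y (j * b + l)) \<le> cmod (y (j * b + g y j))"
      by blast
    \<comment> \<open>Every block in which \<open>w\<close> misses the position \<open>g y j\<close>
      costs a factor \<open>1 / b\<close>. A centre \<open>y\<close> close to \<open>x w\<close> is
      missed in at most half of the blocks, so its weight is at least
      \<open>b powr (- (m / 2))\<close>.\<close>
    define f where "f y w = (\<Prod>j<m. if w j = g y j then 1 else 1 / real b)" for y w
    show "c * real m powr (recip q - recip p) \<le> entropy_id p q n k"
    proof (rule entropy_id_ge[OF assms n], rule ccontr)
      fix r Y assume r: "r > 0" and cov: "covers p q n Y r" and card: "card Y \<le> 2 ^ (k - 1)"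
      assume "\<not> c * real m powr (recip q - recip p) \<le> r"
      then have rlt: "r \<le> c * h * real m powr recip q" using km
        by (simp add: h_def powr_diff powr_minus field_simps)
      have "real (card W) * (real b powr (- (real m / 2))) \<le> real (card Y) * 2 ^ m"
      proof (rule weighted_cover_bound[where f = f])
        show "finite Y" using cov by (simp add: covers_def)
        show "finite W" by (simp add: W_def finite_PiE)
        show "0 \<le> f y w" for y w by (auto simp: f_def intro!: prod_nonneg)
        show "\<exists>y\<in>Y. real b powr (- (real m / 2)) \<le> f y w" if w: "w \<in> W" for w
        proof -
          have wb: "w j < b" if "j < m" for j using w that by (auto simp: W_def)
          have zero: "x w i = 0" if "i \<notin> (\<lambda>j. j * b + w j) ` {..<m}" for i
          proof (rule ccontr)
            assume "x w i \<noteq> 0"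
            then have i: "i < m * b" "w (i div b) = i mod b" by (auto simp: x_def split: if_splits)
            then have "i div b < m" by (simp add: less_mult_imp_div_less)
            moreover have "i = (i div b) * b + w (i div b)" using i by simp
            ultimately show False using that by blast
          qed
          have "lp_norm p n (x w) \<le> 1" using assms(1)
          proof (cases rule: ereal_pos_cases)
            case inf
            then show ?thesis using n by (auto simp: lp_norm_inf_le_iff x_def h_def)
          next
            case (fin a)
            have "(\<Sum>i<n. cmod (x w i) powr a) = (\<Sum>i\<in>(\<lambda>j. j * b + w j) ` {..<m}. cmod (x w i) powr a)"
              using zero coord wb by (intro sum.mono_neutral_right) auto
            also have "\<dots> \<le> (\<Sum>i\<in>(\<lambda>j. j * b + w j) ` {..<m}. h powr a)"
              using h fin by (intro sum_mono powr_mono2) (auto simp: x_def)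
            also have "\<dots> \<le> real m * h powr a"
              using card_image_le[of "{..<m}" "\<lambda>j. j * b + w j"] by (simp add: mult_right_mono)
            also have "h powr a = real m powr (- 1)"
              unfolding h_def powr_powr using fin by simp
            also have "real m * real m powr (- 1) = 1" using km by (simp add: powr_minus)
            finally show ?thesis using fin by (simp add: lp_norm_le_iff)
          qed
          moreover have "x w i = 0" if "i \<ge> n" for i using that km by (simp add: x_def)
          ultimately have "x w \<in> lp_ball p n" by (simp add: lp_ball_def cvec_def)
          then obtain y where y: "y \<in> Y" "lp_norm q n (x w - y) \<le> r"
            using cov by (auto simp: covers_def)
          define D where "D = {j\<in>{..<m}. w j \<noteq> g y j}"
          \<comment> \<open>For a missed block, \<open>d j\<close> is an index inside the block at
            which \<open>x w - y\<close> has modulus at least \<open>h / 2\<close>. If the entry at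
            \<open>w j\<close> fails this, then \<open>y\<close> exceeds \<open>h / 2\<close> there,
            hence also at its largest position \<open>g y j\<close>, where \<open>x w\<close>
            vanishes.\<close>
          define d where "d j = j * b + (if h / 2 \<le> cmod ((x w - y) (j * b + w j)) then w j else g y j)" for j
          have inj: "inj_on d D"
          proof (rule inj_onI)
            fix i j assume *: "i \<in> D" "j \<in> D" "d i = d j"
            have div: "d i div b = i" if i: "i \<in> D" for i
            proof -
              define l where "l = (if h / 2 \<le> cmod ((x w - y) (i * b + w i)) then w i else g y i)"
              have "d i = i * b + l" by (simp only: d_def l_def)
              moreover have "l < b" using i wb g(1) by (simp add: l_def D_def)
              ultimately show ?thesis by simp
            qed
            have "i = d i div b" by (rule div[OF *(1), symmetric])
            also have "\<dots> = d j div b" by (rule arg_cong[OF *(3)])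
            also have "\<dots> = j" by (rule div[OF *(2)])
            finally show "i = j" .
          qed
          have "2 * card (d ` D) \<le> m"
          proof (rule c(2)[OF n km(2) h])
            show "lp_norm q n (x w - y) \<le> c * h * real m powr recip q" using y rlt by simp
            show "d ` D \<subseteq> {..<n}" using coord wb g(1) by (auto simp: d_def D_def)
            fix i assume "i \<in> d ` D"
            then obtain j where j: "i = d j" "j < m" "w j \<noteq> g y j" by (auto simp: D_def)
            show "h / 2 \<le> cmod ((x w - y) i)"
            proof (cases "h / 2 \<le> cmod ((x w - y) (j * b + w j))")
              case True
              then show ?thesis using j by (simp add: d_def)
            next
              case False
              have "cmod (complex_of_real h - y (j * b + w j)) < h / 2"
                using False j wb by (simp add: x_block)
              moreover have "h \<le> cmod (complex_of_real h - y (j * b + w j)) + cmod (y (j * b + w j))"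
                using norm_triangle_sub[of "complex_of_real h" "y (j * b + w j)"] h by simp
              ultimately have "h / 2 \<le> cmod (y (j * b + w j))" by linarith
              also have "\<dots> \<le> cmod (y (j * b + g y j))" using g(2) wb j by blast
              also have "\<dots> = cmod ((x w - y) i)"
                using False j g(1) by (simp add: d_def x_block)
              finally show ?thesis .
            qed
          qed
          then have cD: "2 * card D \<le> m" using card_image[OF inj] by simp
          have "f y w = (1 / real b) ^ card D"
          proof -
            have "{..<m} \<inter> - {j. w j = g y j} = D" by (auto simp: D_def)
            then show ?thesis unfolding f_def by (subst prod.If_cases) auto
          qed
          also have "\<dots> = real b powr (- real (card D))"
            using km by (simp add: powr_minus powr_realpow power_one_over inverse_eq_divide)
          finally have "real b powr (- (real m / 2)) \<le> f y w"
            using cD km by (auto intro!: powr_mono)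
          then show ?thesis using y by blast
        qed
        show "(\<Sum>w\<in>W. f y w) \<le> 2 ^ m" for y
        proof -
          have "(\<Sum>w\<in>W. f y w) = (\<Prod>j<m. \<Sum>l<b. if l = g y j then 1 else 1 / real b)"
            unfolding W_def f_def by (subst prod_sum_PiE) auto
          also have "\<dots> \<le> (\<Prod>j<m. 2)"
          proof (intro prod_mono conjI sum_nonneg)
            fix j
            \<comment> \<open>One position has weight 1 and the others together at most
              \<open>b * (1 / b)\<close>, so a block contributes at most 2.\<close>
            have "(\<Sum>l<b. if l = g y j then 1 else 1 / real b)
              \<le> (\<Sum>l<b. (if l = g y j then 1 else 0) + 1 / real b)"
              by (intro sum_mono) auto
            also have "\<dots> = 2" using g(1)[of y j] km by (simp add: sum.distrib)
            finally show "(\<Sum>l<b. if l = g y j then 1 else 1 / real b) \<le> 2" .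
          qed auto
          finally show ?thesis by simp
        qed
      qed
      moreover have "real (card W) = real b powr real m"
        using km by (simp add: W_def card_PiE powr_realpow)
      ultimately have "real b powr (real m + - (real m / 2)) \<le> real (card Y) * 2 ^ m"
        by (simp only: powr_add)
      also have "\<dots> \<le> 2 ^ (k - 1) * 2 ^ m"
        using card by (intro mult_right_mono, metis of_nat_le_iff of_nat_numeral of_nat_power) simp
      also have "\<dots> = 2 powr (real k - 1 + real m)"
        using powr_realpow[of 2 "k - 1"] powr_realpow[of 2 m] km by (simp add: powr_add of_nat_diff)
      finally have "log 2 (real b powr (real m / 2)) \<le> log 2 (2 powr (real k - 1 + real m))"
        using km by (subst log_le_cancel_iff) auto
      then have le: "real m / 2 * log 2 (real b) \<le> real k - 1 + real m"
        using km by (simp add: log_powr)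
      \<comment> \<open>Now \<open>m\<close> is at most a quarter of \<open>m * log 2 b\<close>, and
        \<open>k\<close> is at most another quarter. The \<open>- 1\<close> stemming from
        \<open>2 ^ (k - 1)\<close> then contradicts \<open>le\<close>.\<close>
      have "4 \<le> log 2 (real b)" using km by (simp add: le_log_iff)
      then have "real m * 4 \<le> real m * log 2 (real b)" by (intro mult_left_mono) auto
      with le km(5) show False by simp
    qed
  qed
qed

section \<open>Lower bounds in the ranges of \<open>k\<close> up to \<open>2 * n\<close>\<close>

lemma two_powr_bounds:
  assumes "1 \<le> n" "1 \<le> k" "k \<le> 2 * n"
  shows "1 / 2 \<le> 2 powr (- (real k - 1) / (2 * real n))"
proof -
  have "(2::real) powr (- 1) \<le> 2 powr (- (real k - 1) / (2 * real n))"
    using assms by (intro powr_mono) (auto simp: divide_simps)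
  then show ?thesis by (simp add: powr_minus)
qed

lemma entropy_lower_small_k:
  assumes "0 < p" "0 < q"
  obtains c where "0 < c" "\<And>n k. \<lbrakk>1 \<le> n; 1 \<le> k; k \<le> 2 * n\<rbrakk> \<Longrightarrow>
    c * real n powr (recip q - recip p) \<le> entropy_id p q n k"
proof -
  obtain c where c: "0 < c" "\<And>n k. \<lbrakk>1 \<le> n; 1 \<le> k\<rbrakk> \<Longrightarrow>
    c * (2 powr (- (real k - 1) / (2 * real n)) * real n powr (recip q - recip p)) \<le> entropy_id p q n k"
    by (rule entropy_lower_volume[OF assms]) blast
  show thesis
  proof (rule that[of "c / 2"])
    fix n k :: nat assume nk: "1 \<le> n" "1 \<le> k" "k \<le> 2 * n"
    have "c / 2 * real n powr (recip q - recip p) = c * (1 / 2 * real n powr (recip q - recip p))" by simp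
    also have "\<dots> \<le> c * (2 powr (- (real k - 1) / (2 * real n)) * real n powr (recip q - recip p))"
      using c two_powr_bounds[OF nk] by (intro mult_left_mono mult_right_mono) auto
    also have "\<dots> \<le> entropy_id p q n k" using c nk by blast
    finally show "c / 2 * real n powr (recip q - recip p) \<le> entropy_id p q n k" .
  qed (use c in simp)
qed

lemma log2_of_nat_le: "log 2 (real N) \<le> real N"
proof (cases "N = 0")
  case False
  have "real N \<le> 2 powr real N"
    using of_nat_less_two_power[of N, where 'a = real] by (simp add: powr_realpow)
  then show ?thesis using False by (simp add: log_le_iff)
\<comment> \<open>The remaining case uses that \<open>ln 0\<close> is \<open>0\<close> in
  HOL.\<close>
qed (simp add: log_def)

lemma real_div_ge:
  assumes "1 \<le> m"
  shows "real n / real m - 1 \<le> real (n div m)"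
  using floor_divide_of_nat_eq[of n m, where 'a = real] by linarith

text \<open>A fixed number of blocks gives a bound independent of \<open>n\<close>. With 8 blocks of
  length \<open>b = n div 8\<close> the admissible \<open>k\<close> reach
  \<open>2 * log 2 b\<close>, which is at least \<open>log 2 (2 * n)\<close> for
  \<open>n > 256\<close>. Smaller dimensions are covered by the full grid.\<close>

lemma entropy_lower_log_k:
  assumes "0 < p" "0 < q" "p \<le> q"
  obtains c where "0 < c" "\<And>n k. \<lbrakk>1 \<le> n; 1 \<le> k; real k \<le> log 2 (2 * real n)\<rbrakk> \<Longrightarrow> c \<le> entropy_id p q n k"
proof -
  define \<alpha> where "\<alpha> = recip p - recip q"
  have \<alpha>: "\<alpha> \<ge> 0" using recip_antimono assms by (simp add: \<alpha>_def)
  have \<alpha>': "recip q - recip p = - \<alpha>" by (simp add: \<alpha>_def)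
  obtain c1 where c1: "0 < c1" "\<And>n k. \<lbrakk>1 \<le> n; 1 \<le> k; k \<le> 2 * n\<rbrakk> \<Longrightarrow>
    c1 * real n powr (- \<alpha>) \<le> entropy_id p q n k"
    using entropy_lower_small_k[OF assms(1,2)] unfolding \<alpha>' by blast
  obtain c2 where c2: "0 < c2" "\<And>n k m b. \<lbrakk>1 \<le> k; 1 \<le> m; 16 \<le> b; m * b \<le> n; 4 * real k \<le> real m * log 2 (real b)\<rbrakk>
    \<Longrightarrow> c2 * real m powr (- \<alpha>) \<le> entropy_id p q n k"
    using entropy_lower_blocks[OF assms(1,2)] unfolding \<alpha>' by blast
  show thesis
  proof (rule that[of "min (c1 * 256 powr (- \<alpha>)) (c2 * 8 powr (- \<alpha>))"])
    show "0 < min (c1 * 256 powr (- \<alpha>)) (c2 * 8 powr (- \<alpha>))" using c1 c2 by simp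
    fix n k :: nat assume nk: "1 \<le> n" "1 \<le> k" "real k \<le> log 2 (2 * real n)"
    have k2n: "k \<le> 2 * n" using nk log2_of_nat_le[of "2 * n"] by simp
    show "min (c1 * 256 powr (- \<alpha>)) (c2 * 8 powr (- \<alpha>)) \<le> entropy_id p q n k"
    proof (cases "n \<le> 256")
      case True
      then have "c1 * 256 powr (- \<alpha>) \<le> c1 * real n powr (- \<alpha>)"
        using nk c1 \<alpha> by (intro mult_left_mono powr_mono2') auto
      then show ?thesis using c1(2)[OF nk(1,2) k2n] by linarith
    next
      case False
      define b where "b = n div 8"
      have "real b \<ge> real n / 8 - 1" unfolding b_def using real_div_ge[of 8 n] by simp
      then have "(real n / 8 - 1) * (real n / 8 - 1) \<le> real b * real b"
        using False by (intro mult_mono) auto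
      moreover have "2 * real n \<le> (real n / 8 - 1) * (real n / 8 - 1)"
      proof -
        have "real n * 256 \<le> real n * real n" using False by (intro mult_left_mono) auto
        moreover have "(real n / 8 - 1) * (real n / 8 - 1) = real n * real n / 64 - real n / 4 + 1"
          by (simp add: algebra_simps)
        ultimately show ?thesis by linarith
      qed
      ultimately have "2 * real n \<le> real b * real b" by linarith
      then have "log 2 (2 * real n) \<le> log 2 (real b * real b)"
        using nk by (intro log_mono) auto
      also have "\<dots> = 2 * log 2 (real b)"
        using False by (simp add: log_mult b_def)
      finally have "4 * real k \<le> real 8 * log 2 (real b)" using nk by simp
      then have "c2 * real 8 powr (- \<alpha>) \<le> entropy_id p q n k"
        using False nk by (intro c2(2)[of k 8 b n]) (auto simp: b_def)
      then show ?thesis by simp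
    qed
  qed
qed

text \<open>Take \<open>m\<close> about \<open>8 * (k / l)\<close> and \<open>b = n div m\<close>.
  With \<open>t = 2 * n / k\<close> this makes \<open>b\<close> at least
  \<open>sqrt (1 + t)\<close>, so \<open>log 2 b\<close> is at least \<open>l / 2\<close>. The
  threshold 255 gives \<open>1 + t \<ge> 256\<close>, hence \<open>l \<ge> 8\<close> and
  \<open>b \<ge> 16\<close>.\<close>

lemma block_parameters:
  fixes n k :: nat and l :: real
  defines "l \<equiv> log 2 (1 + 2 * real n / real k)"
  assumes "2 \<le> k" "log 2 (2 * real n) \<le> real k" "255 \<le> 2 * real n / real k"
  obtains m b where "1 \<le> m" "16 \<le> b" "m * b \<le> n" "4 * real k \<le> real m * log 2 (real b)"
    "real m \<le> 9 * (real k / l)"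
proof -
  define t where "t = 2 * real n / real k"
  have t: "t \<ge> 255" using assms by (simp add: t_def)
  have lt: "l = log 2 (1 + t)" by (simp add: l_def t_def)
  have l8: "8 \<le> l" using t by (simp add: lt le_log_iff)
  have n: "n \<ge> 1" using t by (cases n) (auto simp: t_def)
  \<comment> \<open>The assumption \<open>2 \<le> k\<close> enters here and leads to
    \<open>l \<le> k\<close>, so that rounding \<open>8 * (k / l)\<close> up stays below
    \<open>9 * (k / l)\<close>.\<close>
  have "t \<le> real n" using assms(2) n by (simp add: t_def divide_simps)
  then have "l \<le> log 2 (2 * real n)" unfolding lt using t n by (intro log_mono) auto
  then have lk: "1 \<le> real k / l" using assms(3) l8 by simp
  define m where "m = nat \<lceil>8 * (real k / l)\<rceil>"
  have m: "8 * (real k / l) \<le> real m" "real m \<le> 9 * (real k / l)"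
    using lk unfolding m_def by linarith+
  have m1: "m \<ge> 1" using m lk by linarith
  define b where "b = n div m"
  have u: "sqrt (1 + t) \<ge> 16" using t by (intro real_le_rsqrt) simp
  \<comment> \<open>At \<open>s = sqrt (1 + t)\<close> the right-hand side is
    \<open>t * 8 / 18 - 1\<close>; the \<open>- 1\<close> leaves room for the rounding in
    \<open>n div m\<close>.\<close>
  have "s \<le> (s * s - 1) * (4 / 9) - 1" if "16 \<le> s" for s :: real
  proof -
    have "s * 16 \<le> s * s" using that by (intro mult_left_mono) auto
    then show ?thesis using that by argo
  qed
  from this[OF u] have "sqrt (1 + t) \<le> (sqrt (1 + t) * sqrt (1 + t) - 1) * (4 / 9) - 1" .
  also have "\<dots> = t * 8 / 18 - 1" using t by simp
  also have "\<dots> \<le> t * l / 18 - 1" using t l8 by simp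
  also have "t * l / 18 = real n / (9 * (real k / l))" using l8 assms(2) by (simp add: t_def field_simps)
  also have "\<dots> \<le> real n / real m" using m m1 l8 assms(2) by (intro divide_left_mono mult_pos_pos) auto
  also have "real n / real m - 1 \<le> real b" unfolding b_def using real_div_ge[OF m1] by simp
  finally have b: "sqrt (1 + t) \<le> real b" by simp
  have "l / 2 = log 2 (sqrt (1 + t))" using t by (simp add: lt log_def ln_sqrt)
  also have "\<dots> \<le> log 2 (real b)" using b u t by (intro log_mono) auto
  finally have lb: "l / 2 \<le> log 2 (real b)" .
  have "4 * real k = 8 * (real k / l) * (l / 2)" using l8 by simp
  also have "\<dots> \<le> real m * log 2 (real b)" using m lb l8 by (intro mult_mono) auto
  finally show thesis using b u m1 m(2) by (intro that[of m b]) (auto simp: b_def)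
qed

text \<open>The cases split at \<open>2 * n / k = 255\<close>. Below it the quotient of the
  logarithm and \<open>k\<close> is at most a constant times \<open>1 / n\<close>, and the full grid
  suffices. Above it the block bound applies with the parameters of
  \<open>block_parameters\<close>.\<close>

lemma entropy_lower_middle_k:
  assumes "0 < p" "0 < q" "p \<le> q"
  obtains c where "0 < c" "\<And>n k. \<lbrakk>1 \<le> n; 1 \<le> k; log 2 (2 * real n) \<le> real k; k \<le> 2 * n\<rbrakk> \<Longrightarrow>
    c * (log 2 (1 + 2 * real n / real k) / real k) powr (recip p - recip q) \<le> entropy_id p q n k"
proof -
  define \<alpha> where "\<alpha> = recip p - recip q"
  have \<alpha>: "\<alpha> \<ge> 0" using recip_antimono assms by (simp add: \<alpha>_def)
  have \<alpha>': "recip q - recip p = - \<alpha>" by (simp add: \<alpha>_def)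
  obtain c1 where c1: "0 < c1" "\<And>n k. \<lbrakk>1 \<le> n; 1 \<le> k; k \<le> 2 * n\<rbrakk> \<Longrightarrow>
    c1 * real n powr (- \<alpha>) \<le> entropy_id p q n k"
    using entropy_lower_small_k[OF assms(1,2)] unfolding \<alpha>' by blast
  obtain c2 where c2: "0 < c2" "\<And>n k m b. \<lbrakk>1 \<le> k; 1 \<le> m; 16 \<le> b; m * b \<le> n; 4 * real k \<le> real m * log 2 (real b)\<rbrakk>
    \<Longrightarrow> c2 * real m powr (- \<alpha>) \<le> entropy_id p q n k"
    using entropy_lower_blocks[OF assms(1,2)] unfolding \<alpha>' by blast
  \<comment> \<open>The number 1020 is \<open>8 * 255 / 2\<close>, from \<open>l \<le> 8\<close> and
    \<open>2 * n < 255 * k\<close> in the first case; 9 is the factor in the bound on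
    \<open>m\<close> in the second.\<close>
  define c where "c = min (c1 * 1020 powr (- \<alpha>)) (c2 * 9 powr (- \<alpha>))"
  show thesis
  proof (rule that[of c], unfold \<alpha>_def[symmetric])
    show "0 < c" using c1 c2 by (simp add: c_def)
    fix n k :: nat
    assume nk: "1 \<le> n" "1 \<le> k" "log 2 (2 * real n) \<le> real k" "k \<le> 2 * n"
    define l where "l = log 2 (1 + 2 * real n / real k)"
    have "2 * real n / real k > 0" using nk by simp
    then have l: "l > 0" unfolding l_def by (subst zero_less_log_cancel_iff) auto
    show "c * (log 2 (1 + 2 * real n / real k) / real k) powr \<alpha> \<le> entropy_id p q n k"
      unfolding l_def[symmetric]
    proof (cases "2 * real n / real k < 255")
      case True
      then have "l \<le> 8" using nk by (simp add: l_def log_le_iff add_pos_nonneg)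
      then have "l / real k \<le> 8 / real k" using nk by (simp add: divide_right_mono)
      also have "\<dots> \<le> 1020 / real n" using True nk by (simp add: field_simps)
      finally have "(l / real k) powr \<alpha> \<le> (1020 / real n) powr \<alpha>"
        using l nk \<alpha> by (intro powr_mono2) auto
      then have "c * (l / real k) powr \<alpha> \<le> (c1 * 1020 powr (- \<alpha>)) * (1020 / real n) powr \<alpha>"
        using c1 c2 by (intro mult_mono) (auto simp: c_def)
      also have "\<dots> = c1 * real n powr (- \<alpha>)"
        using nk by (simp add: powr_divide powr_minus field_simps)
      also have "\<dots> \<le> entropy_id p q n k" using c1 nk by blast
      finally show "c * (l / real k) powr \<alpha> \<le> entropy_id p q n k" .
    next
      case False
      \<comment> \<open>If \<open>k = 1\<close>, then \<open>log 2 (2 * n) \<le> k\<close> forces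
        \<open>n = 1\<close>, and \<open>2 * n / k\<close> is only 2.\<close>
      have k2: "2 \<le> k"
      proof (rule ccontr)
        assume "\<not> 2 \<le> k"
        then have "k = 1" using nk by simp
        then show False using nk False by (simp add: log_le_iff)
      qed
      have "255 \<le> 2 * real n / real k" using False by simp
      then obtain m b where mb: "1 \<le> m" "16 \<le> b" "m * b \<le> n" "4 * real k \<le> real m * log 2 (real b)"
        "real m \<le> 9 * (real k / l)"
        using block_parameters[OF k2 nk(3)] unfolding l_def by blast
      have "c * (l / real k) powr \<alpha> \<le> (c2 * 9 powr (- \<alpha>)) * (l / real k) powr \<alpha>"
        by (intro mult_right_mono) (auto simp: c_def)
      also have "\<dots> = c2 * (9 * (real k / l)) powr (- \<alpha>)"
        using l nk by (simp add: powr_mult powr_divide powr_minus field_simps)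
      also have "\<dots> \<le> c2 * real m powr (- \<alpha>)"
        using c2 mb \<alpha> by (intro mult_left_mono powr_mono2') auto
      also have "\<dots> \<le> entropy_id p q n k" using c2(2)[OF nk(2) mb(1-4)] .
      finally show "c * (l / real k) powr \<alpha> \<le> entropy_id p q n k" .
    qed
  qed
qed

subsection \<open>Upper bounds\<close>

lemma one_le_cmod_gauss_int:
  assumes "z \<in> gauss_int J" "z \<noteq> 0"
  shows "1 \<le> cmod z"
proof -
  obtain a b :: int where z: "z = Complex (of_int a) (of_int b)" using assms by (auto simp: gauss_int_def)
  then have "a \<noteq> 0 \<or> b \<noteq> 0" using assms by (auto simp: complex_eq_iff)
  then have "1 \<le> \<bar>Re z\<bar> \<or> 1 \<le> \<bar>Im z\<bar>" using z by auto
  then show ?thesis using abs_Re_le_cmod[of z] abs_Im_le_cmod[of z] by linarith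
qed

text \<open>The term at \<open>0\<close> is 1. At every other \<open>z\<close> the modulus is at
  least 1, so \<open>s0 * cmod z powr a\<close> dominates \<open>4 * ln (1 + cmod z)\<close>, and
  the rest of the exponent is at most \<open>s0 - s\<close>. This leaves \<open>exp (s0 - s)\<close>
  times a sum of inverse fourth powers.\<close>

lemma sum_exp_gauss_int_le:
  fixes a s :: real
  defines "s0 \<equiv> 4 * (1 + 1 / a)"
  assumes "finite J" "0 < a" "s0 \<le> s"
  shows "(\<Sum>z\<in>gauss_int J. exp (- s * cmod z powr a)) \<le> 1 + 16 * exp (s0 - s)"
proof -
  let ?G = "gauss_int J"
  have "exp (- s * cmod z powr a) \<le> (if z = 0 then 1 else 0) + exp (s0 - s) * (1 / (1 + cmod (z - 0)) ^ 4)"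
    if z: "z \<in> ?G" for z
  proof (cases "z = 0")
    case False
    define t where "t = cmod z"
    have t: "1 \<le> t" using one_le_cmod_gauss_int[OF z False] by (simp add: t_def)
    then have ta: "1 \<le> t powr a" using assms by (simp add: ge_one_powr_ge_zero)
    have "ln (1 + t) \<le> 1 + t powr a / a" using ln_add_one_le_powr[of a t] assms t by simp
    also have "\<dots> \<le> (1 + 1 / a) * t powr a" using ta by (simp add: algebra_simps)
    finally have "4 * ln (1 + t) \<le> 4 * ((1 + 1 / a) * t powr a)" by linarith
    then have "4 * ln (1 + t) \<le> s0 * t powr a" by (simp only: s0_def mult.assoc)
    moreover have "(s - s0) * 1 \<le> (s - s0) * t powr a" using ta assms by (intro mult_left_mono) auto
    ultimately have "- s * t powr a \<le> (s0 - s) + (- (4 * ln (1 + t)))" by (simp add: algebra_simps)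
    then have "exp (- s * t powr a) \<le> exp ((s0 - s) + (- (4 * ln (1 + t))))" by simp
    also have "\<dots> = exp (s0 - s) * (1 / exp (4 * ln (1 + t)))"
      by (subst exp_add, subst exp_minus) (simp add: divide_inverse)
    also have "exp (4 * ln (1 + t)) = exp (real 4 * ln (1 + t))" by simp
    also have "\<dots> = exp (ln (1 + t)) ^ 4" by (rule exp_of_nat_mult)
    also have "exp (ln (1 + t)) = 1 + t" using t by simp
    finally show ?thesis using False by (simp add: t_def)
  qed simp
  then have "(\<Sum>z\<in>?G. exp (- s * cmod z powr a))
    \<le> (\<Sum>z\<in>?G. (if z = 0 then 1 else 0) + exp (s0 - s) * (1 / (1 + cmod (z - 0)) ^ 4))"
    by (rule sum_mono)
  also have "\<dots> = (\<Sum>z\<in>?G. if z = 0 then 1 else 0) + exp (s0 - s) * (\<Sum>z\<in>?G. 1 / (1 + cmod (z - 0)) ^ 4)"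
    by (simp only: sum.distrib sum_distrib_left)
  also have "\<dots> \<le> 1 + exp (s0 - s) * 16"
    using sum_gauss_int_le[OF assms(2), of 0] assms(2)
    by (intro add_mono mult_left_mono) auto
  finally show ?thesis by (simp add: mult.commute)
qed

text \<open>Exponential Markov inequality: each counted \<open>w\<close> is weighted by
  \<open>exp (s * (L - S w)) \<ge> 1\<close>, where \<open>S w\<close> is the sum of the
  \<open>a\<close>-th powers of its moduli. Summed over all vectors, this weight factors over the
  coordinates. The bound does not depend on \<open>J\<close>.\<close>

lemma card_gauss_int_vectors_le:
  fixes a s L :: real
  defines "s0 \<equiv> 4 * (1 + 1 / a)"
  assumes "finite J" "0 < a" "s0 \<le> s"
  shows "real (card {w \<in> {..<n} \<rightarrow>\<^sub>E gauss_int J. (\<Sum>i<n. cmod (w i) powr a) \<le> L})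
    \<le> exp (s * L + 16 * exp (s0 - s) * real n)"
proof -
  let ?P = "{..<n} \<rightarrow>\<^sub>E gauss_int J"
  let ?W = "{w \<in> ?P. (\<Sum>i<n. cmod (w i) powr a) \<le> L}"
  let ?S = "\<lambda>w. \<Sum>i<n. cmod (w i) powr a"
  have finP: "finite ?P" using assms by (simp add: finite_PiE)
  have s: "0 \<le> s" using assms by (auto simp: s0_def intro: order_trans[of 0 "4 * (1 + 1 / a)" s])
  have "real (card ?W) = (\<Sum>w\<in>?W. 1)" by simp
  also have "\<dots> \<le> (\<Sum>w\<in>?W. exp (s * (L - ?S w)))"
  proof (rule sum_mono)
    fix w assume "w \<in> ?W"
    then have "0 \<le> s * (L - ?S w)" using s by (intro mult_nonneg_nonneg) auto
    then show "1 \<le> exp (s * (L - ?S w))" by simp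
  qed
  also have "\<dots> \<le> (\<Sum>w\<in>?P. exp (s * (L - ?S w)))"
    using finP by (intro sum_mono2) auto
  also have "\<dots> = (\<Sum>w\<in>?P. exp (s * L) * (\<Prod>i<n. exp (- s * cmod (w i) powr a)))"
  proof (rule sum.cong[OF refl])
    fix w
    have "s * (L - ?S w) = s * L + (\<Sum>i<n. - s * cmod (w i) powr a)"
      by (simp add: algebra_simps sum_distrib_left sum_negf)
    then show "exp (s * (L - ?S w)) = exp (s * L) * (\<Prod>i<n. exp (- s * cmod (w i) powr a))"
      by (simp only: exp_add exp_sum[OF finite_lessThan])
  qed
  also have "\<dots> = exp (s * L) * (\<Prod>i<n. \<Sum>z\<in>gauss_int J. exp (- s * cmod z powr a))"
    using assms(2) by (subst prod_sum_PiE) (auto simp: sum_distrib_left)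
  also have "\<dots> \<le> exp (s * L) * (\<Prod>i<n. exp (16 * exp (s0 - s)))"
  proof (intro mult_left_mono prod_mono conjI sum_nonneg)
    have "(\<Sum>z\<in>gauss_int J. exp (- s * cmod z powr a)) \<le> 1 + 16 * exp (s0 - s)"
      using sum_exp_gauss_int_le[OF assms(2,3)] assms(4) unfolding s0_def by blast
    also have "\<dots> \<le> exp (16 * exp (s0 - s))" by (rule exp_ge_add_one_self)
    finally show "(\<Sum>z\<in>gauss_int J. exp (- s * cmod z powr a)) \<le> exp (16 * exp (s0 - s))" .
  qed auto
  also have "\<dots> = exp (s * L + 16 * exp (s0 - s) * real n)"
    by (simp add: exp_add exp_of_nat2_mult)
  finally show ?thesis .
qed

section \<open>Rounding towards zero and coverings for \<open>k\<close> up to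
  \<open>2 * n\<close>\<close>

text \<open>Rounding towards \<open>0\<close> rather than to the nearest integer keeps both the
  rounded value and the error bounded by \<open>\<bar>t\<bar>\<close>. The former lets the rounded
  vectors be counted, the latter allows the error to be interpolated.\<close>

definition trunc :: "real \<Rightarrow> int" where
  "trunc t = (if 0 \<le> t then \<lfloor>t\<rfloor> else \<lceil>t\<rceil>)"

lemma trunc_bounds:
  "\<bar>of_int (trunc t)\<bar> \<le> \<bar>t\<bar>" "\<bar>t - of_int (trunc t)\<bar> \<le> \<bar>t\<bar>" "\<bar>t - of_int (trunc t)\<bar> \<le> 1"
  unfolding trunc_def by (auto; linarith)+

definition ctrunc :: "complex \<Rightarrow> complex" where
  "ctrunc z = Complex (of_int (trunc (Re z))) (of_int (trunc (Im z)))"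

lemma cmod_mono:
  assumes "\<bar>Re z\<bar> \<le> \<bar>Re w\<bar>" "\<bar>Im z\<bar> \<le> \<bar>Im w\<bar>"
  shows "cmod z \<le> cmod w"
  using assms unfolding cmod_def by (intro real_sqrt_le_mono add_mono) (auto simp: abs_le_square_iff)

lemma ctrunc_bounds:
  "cmod (ctrunc z) \<le> cmod z" "cmod (z - ctrunc z) \<le> cmod z" "cmod (z - ctrunc z) \<le> 2"
proof -
  show "cmod (ctrunc z) \<le> cmod z" "cmod (z - ctrunc z) \<le> cmod z"
    by (rule cmod_mono; simp add: ctrunc_def trunc_bounds)+
  have "cmod (z - ctrunc z) \<le> \<bar>Re (z - ctrunc z)\<bar> + \<bar>Im (z - ctrunc z)\<bar>" by (rule cmod_le)
  also have "\<dots> \<le> 2" using trunc_bounds(3)[of "Re z"] trunc_bounds(3)[of "Im z"] by (simp add: ctrunc_def)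
  finally show "cmod (z - ctrunc z) \<le> 2" .
qed

text \<open>The centres are \<rho> times vectors of Gaussian integers obtained by rounding
  \<open>x / \<rho>\<close>. Rounding does not increase moduli, so their \<open>a\<close>-th powers
  sum to at most \<open>\<rho> powr (- a)\<close>, and \<open>card_gauss_int_vectors_le\<close>
  counts them.\<close>

lemma grid_cover:
  fixes a \<rho> s :: real
  defines "s0 \<equiv> 4 * (1 + 1 / a)"
  assumes "0 < a" "0 < \<rho>" "s0 \<le> s"
  obtains Y where "finite Y" "Y \<subseteq> cvec n"
    "real (card Y) \<le> exp (s * \<rho> powr (- a) + 16 * exp (s0 - s) * real n)"
    "\<And>x. x \<in> lp_ball (ereal a) n \<Longrightarrow>
      \<exists>y\<in>Y. \<forall>i. cmod (x i - y i) \<le> cmod (x i) \<and> cmod (x i - y i) \<le> 2 * \<rho>"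
proof -
  \<comment> \<open>The coordinates of \<open>x / \<rho>\<close> have modulus at most
    \<open>1 / \<rho>\<close>, so a finite window of Gaussian integers suffices.\<close>
  define N where "N = \<lceil>1 / \<rho>\<rceil>"
  define G where "G = gauss_int {-N..N}"
  define W where "W = {w \<in> {..<n} \<rightarrow>\<^sub>E G. (\<Sum>i<n. cmod (w i) powr a) \<le> \<rho> powr (- a)}"
  define Y where "Y = (\<lambda>w i. if i < n then complex_of_real \<rho> * w i else 0) ` W"
  have "finite ({..<n} \<rightarrow>\<^sub>E G)" by (simp add: G_def finite_PiE)
  then have "finite W" unfolding W_def by (rule rev_finite_subset) auto
  then have finY: "finite Y" and cY: "card Y \<le> card W" by (simp_all add: Y_def card_image_le)
  show thesis
  proof (rule that[OF finY])
    show "Y \<subseteq> cvec n" by (auto simp: Y_def cvec_def)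
    have "real (card W) \<le> exp (s * \<rho> powr (- a) + 16 * exp (s0 - s) * real n)"
      unfolding W_def G_def s0_def using assms by (intro card_gauss_int_vectors_le) auto
    then show "real (card Y) \<le> exp (s * \<rho> powr (- a) + 16 * exp (s0 - s) * real n)" using cY by linarith
    fix x assume x: "x \<in> lp_ball (ereal a) n"
    define w where "w = (\<lambda>i\<in>{..<n}. ctrunc (x i / complex_of_real \<rho>))"
    define y where "y = (\<lambda>i. if i < n then complex_of_real \<rho> * w i else 0)"
    have "w \<in> W"
      unfolding W_def
    proof (intro CollectI conjI)
      have "ctrunc (x i / complex_of_real \<rho>) \<in> G" if i: "i < n" for i
      proof -
        have "1 \<le> n" using i by simp
        then have "cmod (x i / complex_of_real \<rho>) \<le> 1 / \<rho>"
          using lp_ball_coord[OF _ _ x i] assms by (simp add: norm_divide divide_right_mono)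
        then have "\<bar>Re (x i / complex_of_real \<rho>)\<bar> \<le> of_int N" "\<bar>Im (x i / complex_of_real \<rho>)\<bar> \<le> of_int N"
          using abs_Re_le_cmod[of "x i / complex_of_real \<rho>"] abs_Im_le_cmod[of "x i / complex_of_real \<rho>"]
          unfolding N_def by linarith+
        then have "\<bar>real_of_int (trunc (Re (x i / complex_of_real \<rho>)))\<bar> \<le> of_int N"
          "\<bar>real_of_int (trunc (Im (x i / complex_of_real \<rho>)))\<bar> \<le> of_int N"
          using trunc_bounds(1) order_trans by blast+
        moreover have "v \<in> {-N..N}" if "\<bar>real_of_int v\<bar> \<le> of_int N" for v
          unfolding atLeastAtMost_iff using that by linarith
        ultimately have "trunc (Re (x i / complex_of_real \<rho>)) \<in> {-N..N}" "trunc (Im (x i / complex_of_real \<rho>)) \<in> {-N..N}"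
          by blast+
        then show ?thesis unfolding G_def gauss_int_def ctrunc_def
          by (intro image_eqI[of _ _ "(trunc (Re (x i / complex_of_real \<rho>)), trunc (Im (x i / complex_of_real \<rho>)))"]) auto
      qed
      then show "w \<in> {..<n} \<rightarrow>\<^sub>E G" by (auto simp: w_def)
      have "(\<Sum>i<n. cmod (w i) powr a) \<le> (\<Sum>i<n. cmod (x i / complex_of_real \<rho>) powr a)"
        using assms by (intro sum_mono powr_mono2) (auto simp: w_def ctrunc_bounds)
      also have "\<dots> = \<rho> powr (- a) * (\<Sum>i<n. cmod (x i) powr a)"
        unfolding sum_distrib_left using assms
        by (intro sum.cong) (simp_all add: norm_divide powr_divide powr_minus_divide)
      also have "\<dots> \<le> \<rho> powr (- a) * 1"
        using x assms by (intro mult_left_mono) (auto simp: lp_ball_def lp_norm_le_iff)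
      finally show "(\<Sum>i<n. cmod (w i) powr a) \<le> \<rho> powr (- a)" by simp
    qed
    then have "y \<in> Y" by (auto simp: Y_def y_def)
    moreover have "cmod (x i - y i) \<le> cmod (x i) \<and> cmod (x i - y i) \<le> 2 * \<rho>" for i
    proof (cases "i < n")
      case True
      define z where "z = x i / complex_of_real \<rho>"
      have xz: "x i = complex_of_real \<rho> * z" using assms by (simp add: z_def)
      have "x i - y i = complex_of_real \<rho> * (z - ctrunc z)"
        using True by (simp add: y_def w_def xz z_def[symmetric] algebra_simps)
      then show ?thesis using ctrunc_bounds[of z] assms unfolding xz by (simp add: norm_mult)
    next
      case False
      then show ?thesis using x assms by (simp add: lp_ball_def cvec_def y_def)
    qed
    ultimately show "\<exists>y\<in>Y. \<forall>i. cmod (x i - y i) \<le> cmod (x i) \<and> cmod (x i - y i) \<le> 2 * \<rho>" by blast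
  qed
qed

text \<open>With \<open>t = 2 * n / k\<close> and \<open>l = log 2 (1 + t)\<close>, take
  \<open>\<rho> powr a\<close> equal to a constant times \<open>l / k\<close>, and \<open>s\<close>
  equal to \<open>ln (1 + t)\<close> plus a constant. Both terms in the exponent of
  \<open>grid_cover\<close> are then at most \<open>k * ln 2 / 4\<close>.\<close>

lemma cover_middle_k:
  assumes "0 < a"
  obtains C where "0 < C"
    "\<And>n k. \<lbrakk>1 \<le> n; 1 \<le> k; log 2 (2 * real n) \<le> real k; k \<le> 2 * n\<rbrakk> \<Longrightarrow>
      \<exists>Y. finite Y \<and> Y \<subseteq> cvec n \<and> card Y \<le> 2 ^ (k - 1) \<and>
        (\<forall>x\<in>lp_ball (ereal a) n. \<exists>y\<in>Y. \<forall>i. cmod (x i - y i) \<le> cmod (x i) \<and>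
          cmod (x i - y i) \<le> C * (log 2 (1 + 2 * real n / real k) / real k) powr (1 / a))"
proof -
  define s0 where "s0 = 4 * (1 + 1 / a)"
  \<comment> \<open>The summand \<open>ln 64\<close> turns \<open>16 * exp (s0 - s) * n\<close> into
    \<open>n / (4 * (1 + t))\<close>, which is at most \<open>k / 8\<close>. The constant
    \<open>D\<close> is chosen so that \<open>(ln 2 + B) / D = ln 2 / 4\<close>.\<close>
  define B where "B = s0 + ln 64"
  define D where "D = 4 * (ln 2 + B) / ln 2"
  have s0: "s0 > 0" using assms by (simp add: s0_def add_pos_pos)
  have B: "B \<ge> 0" using s0 by (simp add: B_def)
  have D: "D \<ge> 4" using B by (simp add: D_def field_simps)
  show thesis
  proof (rule that[of "2 * D powr (1 / a)"])
    show "0 < 2 * D powr (1 / a)" using D by simp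
    fix n k :: nat
    assume nk: "1 \<le> n" "1 \<le> k" "log 2 (2 * real n) \<le> real k" "k \<le> 2 * n"
    define t where "t = 2 * real n / real k"
    define l where "l = log 2 (1 + t)"
    have t: "t \<ge> 1" using nk by (simp add: t_def)
    have l: "l \<ge> 1" using t by (simp add: l_def le_log_iff)
    define \<rho> where "\<rho> = D powr (1 / a) * (l / real k) powr (1 / a)"
    have \<rho>: "\<rho> > 0" using D l nk by (simp add: \<rho>_def)
    show "\<exists>Y. finite Y \<and> Y \<subseteq> cvec n \<and> card Y \<le> 2 ^ (k - 1) \<and>
        (\<forall>x\<in>lp_ball (ereal a) n. \<exists>y\<in>Y. \<forall>i. cmod (x i - y i) \<le> cmod (x i) \<and>
          cmod (x i - y i) \<le> 2 * D powr (1 / a) * (log 2 (1 + 2 * real n / real k) / real k) powr (1 / a))"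
      unfolding t_def[symmetric] l_def[symmetric]
    proof (cases "k = 1")
      case True
      \<comment> \<open>Only one centre is available; \<open>0\<close> works because the claimed
        radius is at least 1.\<close>
      have D1: "1 \<le> D powr (1 / a)" using D assms by (simp add: ge_one_powr_ge_zero)
      have l1: "1 \<le> l powr (1 / a)" using l assms by (simp add: ge_one_powr_ge_zero)
      have "1 \<le> D powr (1 / a) * l powr (1 / a)" using mult_mono[OF D1 l1] by simp
      then have big: "1 \<le> 2 * D powr (1 / a) * l powr (1 / a)" by simp
      have "cmod (x i) \<le> 1" if "x \<in> lp_ball (ereal a) n" for x i
      proof (cases "i < n")
        case True
        then show ?thesis using lp_ball_coord[OF _ nk(1) that] assms by simp
      next
        case False
        then show ?thesis using that by (simp add: lp_ball_def cvec_def)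
      qed
      then show "\<exists>Y. finite Y \<and> Y \<subseteq> cvec n \<and> card Y \<le> 2 ^ (k - 1) \<and>
        (\<forall>x\<in>lp_ball (ereal a) n. \<exists>y\<in>Y. \<forall>i. cmod (x i - y i) \<le> cmod (x i) \<and>
          cmod (x i - y i) \<le> 2 * D powr (1 / a) * (l / real k) powr (1 / a))"
        using True big by (intro exI[of _ "{\<lambda>_. 0}"]) (auto simp: cvec_def intro: order_trans)
    next
      case False
      then have k2: "2 \<le> k" using nk by simp
      define s where "s = ln (1 + t) + B"
      have ln64: "ln 64 \<ge> (0::real)" by simp
      have s: "s0 \<le> s" using t ln64 unfolding s_def B_def by (smt (verit) ln_ge_zero)
      obtain Y where Y: "finite Y" "Y \<subseteq> cvec n"
        "real (card Y) \<le> exp (s * \<rho> powr (- a) + 16 * exp (s0 - s) * real n)"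
        "\<And>x. x \<in> lp_ball (ereal a) n \<Longrightarrow>
          \<exists>y\<in>Y. \<forall>i. cmod (x i - y i) \<le> cmod (x i) \<and> cmod (x i - y i) \<le> 2 * \<rho>"
        using grid_cover[OF assms \<rho>, of s n] s unfolding s0_def by blast
      have ln2: "ln 2 \<ge> (1/2::real)" using ln2_ge_two_thirds by simp
      have lnt: "ln (1 + t) = l * ln 2" by (simp add: l_def log_def)
      have "\<rho> = (D * (l / real k)) powr (1 / a)" unfolding \<rho>_def by (simp only: powr_mult)
      then have "\<rho> powr (- a) = (D * (l / real k)) powr (- 1)"
        using assms by (simp add: powr_powr)
      also have "\<dots> = real k / (D * l)" using D l nk by (simp add: powr_minus)
      finally have \<rho>a: "\<rho> powr (- a) = real k / (D * l)" .
      have "s \<le> l * (ln 2 + B)" using l B mult_right_mono[OF l B] by (simp add: s_def lnt algebra_simps)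
      then have "s * \<rho> powr (- a) \<le> l * (ln 2 + B) * (real k / (D * l))"
        unfolding \<rho>a using D l by (intro mult_right_mono) auto
      also have "\<dots> = real k * ((ln 2 + B) / D)" using l by simp
      also have "(ln 2 + B) / D = ln 2 / 4"
      proof -
        have "x / (4 * x / y) = y / 4" if "0 < x" "0 < y" for x y :: real
          using that by simp
        note * = this
        show ?thesis unfolding D_def by (rule *) (use B ln2 in linarith)+
      qed
      finally have e1: "s * \<rho> powr (- a) \<le> real k * (ln 2 / 4)" .
      have "ln ((1 + t) * 64) = ln (1 + t) + ln 64" using t by (subst ln_mult) auto
      then have "s0 - s = - ln ((1 + t) * 64)" unfolding s_def B_def by linarith
      then have "exp (s0 - s) = inverse (exp (ln ((1 + t) * 64)))" by (simp only: exp_minus)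
      also have "exp (ln ((1 + t) * 64)) = (1 + t) * 64" using t by (intro exp_ln) auto
      finally have "exp (s0 - s) = 1 / ((1 + t) * 64)" by (simp add: divide_inverse)
      then have "16 * exp (s0 - s) * real n = real n / (4 * (1 + t))" using t by (simp add: field_simps)
      also have "\<dots> \<le> real n / (4 * t)" using t by (intro divide_left_mono) auto
      also have "\<dots> = real k / 8" using nk by (simp add: t_def)
      also have "\<dots> \<le> real k * (ln 2 / 4)" using mult_left_mono[OF ln2, of "real k / 4"] by simp
      finally have e2: "16 * exp (s0 - s) * real n \<le> real k * (ln 2 / 4)" .
      \<comment> \<open>From \<open>k \<ge> 2\<close> follows \<open>k / 2 \<le> k - 1\<close>; this
        is why \<open>k = 1\<close> is treated apart.\<close>
      have "s * \<rho> powr (- a) + 16 * exp (s0 - s) * real n \<le> real k / 2 * ln 2" using e1 e2 by argo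
      also have "\<dots> \<le> real (k - 1) * ln 2" using k2 by (intro mult_right_mono) auto
      finally have "real (card Y) \<le> exp (real (k - 1) * ln 2)" using Y(3) by (meson exp_le_cancel_iff order_trans)
      also have "\<dots> = 2 ^ (k - 1)" by (simp add: exp_of_nat_mult)
      finally have "card Y \<le> 2 ^ (k - 1)" by (metis of_nat_le_iff of_nat_numeral of_nat_power)
      then show "\<exists>Y. finite Y \<and> Y \<subseteq> cvec n \<and> card Y \<le> 2 ^ (k - 1) \<and>
        (\<forall>x\<in>lp_ball (ereal a) n. \<exists>y\<in>Y. \<forall>i. cmod (x i - y i) \<le> cmod (x i) \<and>
          cmod (x i - y i) \<le> 2 * D powr (1 / a) * (l / real k) powr (1 / a))"
        using Y by (intro exI[of _ Y]) (auto simp: \<rho>_def mult.assoc)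
    qed
  qed
qed

section \<open>Subdivision of cubes and coverings for \<open>k\<close> from \<open>2 * n\<close>
  on\<close>

text \<open>The points are the midpoints of \<open>m\<close> equal subintervals of
  \<open>[-1, 1]\<close>; in the proof \<open>u\<close> is \<open>t\<close> rescaled to
  \<open>[0, m]\<close>.\<close>

lemma interval_grid:
  fixes t :: real
  assumes "\<bar>t\<bar> \<le> 1" "1 \<le> m"
  obtains a where "a < m" "\<bar>t - ((2 * real a + 1) / real m - 1)\<bar> \<le> 1 / real m"
proof -
  define u where "u = (t + 1) * real m / 2"
  have "(t + 1) * real m \<le> 2 * real m" using assms by (intro mult_right_mono) auto
  then have u: "0 \<le> u" "u \<le> real m" using assms by (auto simp: u_def)
  obtain a where a: "a < m" "\<bar>u - (real a + 1 / 2)\<bar> \<le> 1 / 2"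
  proof (cases "u < real m")
    case True
    show ?thesis by (rule that[of "nat \<lfloor>u\<rfloor>"]) (use True u in linarith)+
  next
    case False
    \<comment> \<open>The right endpoint \<open>u = m\<close> belongs to the last
      subinterval.\<close>
    show ?thesis by (rule that[of "m - 1"]) (use False u assms in \<open>auto simp: of_nat_diff\<close>)
  qed
  have "t - ((2 * real a + 1) / real m - 1) = 2 / real m * (u - (real a + 1 / 2))"
    using assms by (simp add: u_def field_simps)
  then have "\<bar>t - ((2 * real a + 1) / real m - 1)\<bar> = 2 / real m * \<bar>u - (real a + 1 / 2)\<bar>"
    by (simp only: abs_mult abs_divide abs_numeral abs_of_nat)
  also have "\<dots> \<le> 2 / real m * (1 / 2)" using a by (intro mult_left_mono) auto
  finally show thesis using a by (intro that[of a]) auto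
qed

text \<open>The square around the disc is cut into \<open>m * m\<close> equal squares. Real and
  imaginary part are each off by at most \<open>\<rho> / m\<close>, which adds up to the stated
  error.\<close>

lemma disc_grid:
  assumes "0 < \<rho>" "1 \<le> m"
  obtains D where "finite D" "card D \<le> m\<^sup>2"
    "\<And>z. cmod z \<le> \<rho> \<Longrightarrow> \<exists>d\<in>D. cmod (z - d) \<le> 2 * \<rho> / real m"
proof -
  define g where "g a = \<rho> * ((2 * real a + 1) / real m - 1)" for a
  define D where "D = (\<lambda>(a, b). Complex (g a) (g b)) ` ({..<m} \<times> {..<m})"
  have g: "\<exists>a<m. \<bar>t - g a\<bar> \<le> \<rho> / real m" if "\<bar>t\<bar> \<le> \<rho>" for t
  proof -
    have "\<bar>t / \<rho>\<bar> \<le> 1" using that assms by simp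
    then obtain a where a: "a < m" "\<bar>t / \<rho> - ((2 * real a + 1) / real m - 1)\<bar> \<le> 1 / real m"
      using interval_grid assms(2) by blast
    have "t - g a = \<rho> * (t / \<rho> - ((2 * real a + 1) / real m - 1))"
      using assms by (simp add: g_def right_diff_distrib)
    then have "\<bar>t - g a\<bar> = \<rho> * \<bar>t / \<rho> - ((2 * real a + 1) / real m - 1)\<bar>"
      using assms by (simp add: abs_mult)
    also have "\<dots> \<le> \<rho> * (1 / real m)" using a assms by (intro mult_left_mono) auto
    finally show ?thesis using a by auto
  qed
  show thesis
  proof (rule that[of D])
    show "finite D" by (simp add: D_def)
    show "card D \<le> m\<^sup>2" unfolding D_def
      by (rule order_trans[OF card_image_le]) (simp_all add: card_cartesian_product power2_eq_square)
    fix z assume z: "cmod z \<le> \<rho>"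
    obtain a b where ab: "a < m" "\<bar>Re z - g a\<bar> \<le> \<rho> / real m" "b < m" "\<bar>Im z - g b\<bar> \<le> \<rho> / real m"
      using g[of "Re z"] g[of "Im z"] z abs_Re_le_cmod[of z] abs_Im_le_cmod[of z] by (meson order_trans)
    have "cmod (z - Complex (g a) (g b)) \<le> 2 * \<rho> / real m"
      using cmod_le[of "z - Complex (g a) (g b)"] ab by simp
    then show "\<exists>d\<in>D. cmod (z - d) \<le> 2 * \<rho> / real m" using ab by (force simp: D_def)
  qed
qed

text \<open>Around each centre every one of the \<open>n\<close> complex coordinates is refined by
  the same grid of at most \<open>m * m\<close> points, which multiplies the number of centres by at
  most \<open>m ^ (2 * n)\<close>.\<close>

lemma subdivide_cover:
  assumes "0 < \<rho>" "1 \<le> m" "finite Y" "Y \<subseteq> cvec n" "X \<subseteq> cvec n"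
    and cov: "\<And>x. x \<in> X \<Longrightarrow> \<exists>y\<in>Y. \<forall>i. cmod (x i - y i) \<le> \<rho>"
  obtains Z where "finite Z" "Z \<subseteq> cvec n" "card Z \<le> card Y * m ^ (2 * n)"
    "\<And>x. x \<in> X \<Longrightarrow> \<exists>z\<in>Z. \<forall>i. cmod (x i - z i) \<le> 2 * \<rho> / real m"
proof -
  obtain D where D: "finite D" "card D \<le> m\<^sup>2"
    "\<And>z. cmod z \<le> \<rho> \<Longrightarrow> \<exists>d\<in>D. cmod (z - d) \<le> 2 * \<rho> / real m"
    using disc_grid[OF assms(1,2)] by blast
  define P where "P = ({..<n} \<rightarrow>\<^sub>E D)"
  have finP: "finite P" using D by (simp add: P_def finite_PiE)
  have "card P = card D ^ n" by (simp add: P_def card_PiE)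
  also have "\<dots> \<le> (m\<^sup>2) ^ n" using D by (intro power_mono) auto
  finally have cP: "card P \<le> m ^ (2 * n)" by (simp add: power_mult)
  define F where "F = (\<lambda>(y :: nat \<Rightarrow> complex, w) i. y i + (if i < n then w i else 0))"
  show thesis
  proof (rule that[of "F ` (Y \<times> P)"])
    show "finite (F ` (Y \<times> P))" using finP assms by simp
    show "F ` (Y \<times> P) \<subseteq> cvec n" using assms by (auto simp: F_def cvec_def)
    have "card (F ` (Y \<times> P)) \<le> card (Y \<times> P)" using finP assms by (intro card_image_le) auto
    also have "\<dots> = card Y * card P" by (rule card_cartesian_product)
    also have "\<dots> \<le> card Y * m ^ (2 * n)" using cP by simp
    finally show "card (F ` (Y \<times> P)) \<le> card Y * m ^ (2 * n)" .
    fix x assume x: "x \<in> X"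
    then obtain y where y: "y \<in> Y" "\<And>i. cmod (x i - y i) \<le> \<rho>" using cov by blast
    have "\<exists>d\<in>D. cmod (x i - y i - d) \<le> 2 * \<rho> / real m" for i using D(3) y(2) by blast
    then obtain w where w: "\<And>i. w i \<in> D" "\<And>i. cmod (x i - y i - w i) \<le> 2 * \<rho> / real m" by metis
    have "restrict w {..<n} \<in> P" using w by (auto simp: P_def)
    moreover have "cmod (x i - F (y, restrict w {..<n}) i) \<le> 2 * \<rho> / real m" for i
    proof (cases "i < n")
      case True
      then show ?thesis using w(2)[of i] by (simp add: F_def algebra_simps)
    next
      case False
      then have "x i = 0" "y i = 0" using x y assms by (auto simp: cvec_def subset_iff)
      then show ?thesis using False assms by (simp add: F_def)
    qed
    ultimately show "\<exists>z\<in>F ` (Y \<times> P). \<forall>i. cmod (x i - z i) \<le> 2 * \<rho> / real m" using y by blast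
  qed
qed

text \<open>Start from the covering for \<open>k = 2 * n\<close>, where the logarithm equals 1, and
  spend the remaining factor \<open>2 ^ (k - 2 * n)\<close> in the number of centres on subdividing
  its cubes.\<close>

lemma cover_large_k_finite:
  assumes "0 < a"
  obtains C where "0 < C"
    "\<And>n k. \<lbrakk>1 \<le> n; 2 * n \<le> k\<rbrakk> \<Longrightarrow>
      \<exists>Y. finite Y \<and> Y \<subseteq> cvec n \<and> card Y \<le> 2 ^ (k - 1) \<and>
        (\<forall>x\<in>lp_ball (ereal a) n. \<exists>y\<in>Y. \<forall>i.
          cmod (x i - y i) \<le> C * (2 powr (- (real k - 1) / (2 * real n)) * real n powr (- 1 / a)))"
proof -
  obtain C where C: "0 < C" "\<And>n k. \<lbrakk>1 \<le> n; 1 \<le> k; log 2 (2 * real n) \<le> real k; k \<le> 2 * n\<rbrakk> \<Longrightarrow>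
      \<exists>Y. finite Y \<and> Y \<subseteq> cvec n \<and> card Y \<le> 2 ^ (k - 1) \<and>
        (\<forall>x\<in>lp_ball (ereal a) n. \<exists>y\<in>Y. \<forall>i. cmod (x i - y i) \<le> cmod (x i) \<and>
          cmod (x i - y i) \<le> C * (log 2 (1 + 2 * real n / real k) / real k) powr (1 / a))"
    by (rule cover_middle_k[OF assms]) blast
  show thesis
  proof (rule that[of "8 * C"])
    show "0 < 8 * C" using C(1) by simp
    fix n k :: nat assume nk: "1 \<le> n" "2 * n \<le> k"
    have "log 2 (2 * real n) \<le> real (2 * n)" using log2_of_nat_le[of "2 * n"] by simp
    then obtain Y where Y: "finite Y" "Y \<subseteq> cvec n" "card Y \<le> 2 ^ (2 * n - 1)"
      "\<And>x. x \<in> lp_ball (ereal a) n \<Longrightarrow> \<exists>y\<in>Y. \<forall>i. cmod (x i - y i) \<le> cmod (x i) \<and>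
          cmod (x i - y i) \<le> C * (log 2 (1 + 2 * real n / real (2 * n)) / real (2 * n)) powr (1 / a)"
      using C(2)[of n "2 * n"] nk by auto
    define \<rho> where "\<rho> = C * (1 / (2 * real n)) powr (1 / a)"
    have \<rho>: "\<rho> > 0" using C(1) nk by (simp add: \<rho>_def)
    have Y\<rho>: "\<exists>y\<in>Y. \<forall>i. cmod (x i - y i) \<le> \<rho>" if "x \<in> lp_ball (ereal a) n" for x
      using Y(4)[OF that] nk by (auto simp: \<rho>_def)
    define M where "M = 2 powr ((real k - 1) / (2 * real n))"
    have Minv: "2 powr (- (real k - 1) / (2 * real n)) = 1 / M"
      unfolding M_def by (simp only: powr_minus_divide[symmetric] minus_divide_left)
    \<comment> \<open>The largest real subdivision factor allowed, since
      \<open>v ^ (2 * n) = 2 ^ (k - 2 * n)\<close>. Passing from \<open>M\<close> to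
      \<open>v\<close> and from \<open>v\<close> to its floor loses a factor of at most 2 each time,
      so \<open>M / 4 \<le> m\<close>.\<close>
    define v where "v = 2 powr ((real k - 2 * real n) / (2 * real n))"
    have v1: "1 \<le> v" using nk by (simp add: v_def ge_one_powr_ge_zero)
    have "M / 2 = 2 powr ((real k - 1) / (2 * real n) - 1)" by (simp add: M_def powr_diff)
    also have "\<dots> \<le> v" unfolding v_def using nk by (intro powr_mono) (auto simp: field_simps)
    finally have Mv: "M / 2 \<le> v" .
    define m where "m = nat \<lfloor>v\<rfloor>"
    have "1 \<le> \<lfloor>v\<rfloor>" using v1 by simp
    then have m: "real m \<le> v" "v / 2 \<le> real m" "1 \<le> m" unfolding m_def by linarith+
    have "real m ^ (2 * n) \<le> v ^ (2 * n)" using m by (intro power_mono) auto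
    also have "\<dots> = v powr real (2 * n)" using v1 by (subst powr_realpow) auto
    also have "\<dots> = 2 powr real (k - 2 * n)" using nk by (simp add: v_def powr_powr of_nat_diff)
    also have "\<dots> = 2 ^ (k - 2 * n)" by (rule powr_realpow) simp
    finally have "real (m ^ (2 * n)) \<le> real (2 ^ (k - 2 * n))" by simp
    then have mk: "m ^ (2 * n) \<le> 2 ^ (k - 2 * n)" by (simp only: of_nat_le_iff)
    have "lp_ball (ereal a) n \<subseteq> cvec n" by (auto simp: lp_ball_def)
    then obtain Z where Z: "finite Z" "Z \<subseteq> cvec n" "card Z \<le> card Y * m ^ (2 * n)"
      "\<And>x. x \<in> lp_ball (ereal a) n \<Longrightarrow> \<exists>z\<in>Z. \<forall>i. cmod (x i - z i) \<le> 2 * \<rho> / real m"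
      using subdivide_cover[OF \<rho> m(3) Y(1,2) _ Y\<rho>] by blast
    have "card Z \<le> 2 ^ (2 * n - 1) * 2 ^ (k - 2 * n)"
      by (rule order_trans[OF Z(3) mult_mono[OF Y(3) mk]]) auto
    also have "\<dots> = 2 ^ (k - 1)" using nk by (simp add: power_add[symmetric])
    finally have cZ: "card Z \<le> 2 ^ (k - 1)" .
    have M0: "M > 0" by (simp add: M_def)
    have "M / 4 \<le> real m" using m Mv by linarith
    then have "2 * \<rho> / real m \<le> 2 * \<rho> / (M / 4)" using \<rho> M0 m by (intro divide_left_mono) auto
    also have "\<dots> = 8 * \<rho> / M" by simp
    also have "\<dots> \<le> 8 * C * (1 / M * real n powr (- 1 / a))"
    proof -
      have "(1 / (2 * real n)) powr (1 / a) \<le> (1 / real n) powr (1 / a)"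
        using nk assms by (intro powr_mono2) (auto simp: field_simps)
      also have "\<dots> = real n powr (- 1 / a)" using nk by (simp add: powr_divide powr_minus_divide)
      finally have "\<rho> \<le> C * real n powr (- 1 / a)" unfolding \<rho>_def using C(1) by simp
      then have "8 * \<rho> / M \<le> 8 * (C * real n powr (- 1 / a)) / M" using M0 by (intro divide_right_mono) auto
      then show ?thesis by simp
    qed
    finally have "2 * \<rho> / real m \<le> 8 * C * (1 / M * real n powr (- 1 / a))" .
    then show "\<exists>Y. finite Y \<and> Y \<subseteq> cvec n \<and> card Y \<le> 2 ^ (k - 1) \<and>
        (\<forall>x\<in>lp_ball (ereal a) n. \<exists>y\<in>Y. \<forall>i.
          cmod (x i - y i) \<le> 8 * C * (2 powr (- (real k - 1) / (2 * real n)) * real n powr (- 1 / a)))"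
      unfolding Minv using Z(1,2) cZ Z(4) by (intro exI[of _ Z]) (meson order_trans)
  qed
qed

text \<open>For \<open>p = \<infinity>\<close>, dividing by \<open>n\<close> maps the unit ball into
  that of exponent 1; scaling the centres back by \<open>n\<close> cancels the factor
  \<open>1 / n\<close> in the radius.\<close>

lemma cover_large_k:
  assumes "0 < p"
  obtains C where "0 < C"
    "\<And>n k. \<lbrakk>1 \<le> n; 2 * n \<le> k\<rbrakk> \<Longrightarrow>
      \<exists>Y. finite Y \<and> Y \<subseteq> cvec n \<and> card Y \<le> 2 ^ (k - 1) \<and>
        (\<forall>x\<in>lp_ball p n. \<exists>y\<in>Y. \<forall>i.
          cmod (x i - y i) \<le> C * (2 powr (- (real k - 1) / (2 * real n)) * real n powr (- recip p)))"
  using assms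
proof (cases rule: ereal_pos_cases)
  case (fin a)
  obtain C where C: "0 < C" "\<And>n k. \<lbrakk>1 \<le> n; 2 * n \<le> k\<rbrakk> \<Longrightarrow>
      \<exists>Y. finite Y \<and> Y \<subseteq> cvec n \<and> card Y \<le> 2 ^ (k - 1) \<and>
        (\<forall>x\<in>lp_ball (ereal a) n. \<exists>y\<in>Y. \<forall>i.
          cmod (x i - y i) \<le> C * (2 powr (- (real k - 1) / (2 * real n)) * real n powr (- 1 / a)))"
    by (rule cover_large_k_finite[OF fin(2)]) blast
  show ?thesis by (rule that[OF C(1)]) (use C(2) fin in simp)
next
  case inf
  obtain C where C: "0 < C" "\<And>n k. \<lbrakk>1 \<le> n; 2 * n \<le> k\<rbrakk> \<Longrightarrow>
      \<exists>Y. finite Y \<and> Y \<subseteq> cvec n \<and> card Y \<le> 2 ^ (k - 1) \<and>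
        (\<forall>x\<in>lp_ball (ereal 1) n. \<exists>y\<in>Y. \<forall>i.
          cmod (x i - y i) \<le> C * (2 powr (- (real k - 1) / (2 * real n)) * real n powr (- 1 / 1)))"
    by (rule cover_large_k_finite[OF zero_less_one]) blast
  show ?thesis
  proof (rule that[OF C(1)])
    fix n k :: nat assume nk: "1 \<le> n" "2 * n \<le> k"
    let ?M = "2 powr (- (real k - 1) / (2 * real n))"
    obtain Y where Y: "finite Y" "Y \<subseteq> cvec n" "card Y \<le> 2 ^ (k - 1)"
      "\<And>x. x \<in> lp_ball (ereal 1) n \<Longrightarrow> \<exists>y\<in>Y. \<forall>i. cmod (x i - y i) \<le> C * (?M * real n powr (- 1 / 1))"
      using C(2)[OF nk] by blast
    define Z where "Z = (\<lambda>y i. complex_of_real (real n) * y i) ` Y"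
    have "\<exists>z\<in>Z. \<forall>i. cmod (x i - z i) \<le> C * (?M * real n powr (- recip p))" if x: "x \<in> lp_ball p n" for x
    proof -
      define x' where "x' = (\<lambda>i. x i / complex_of_real (real n))"
      have "(\<Sum>i<n. cmod (x' i) powr 1) \<le> (\<Sum>i<n. 1 / real n)"
        using lp_ball_coord[OF assms nk(1) x] by (intro sum_mono) (auto simp: x'_def norm_divide divide_right_mono)
      also have "\<dots> = 1" using nk by simp
      finally have "lp_norm (ereal 1) n x' \<le> 1" by (subst lp_norm_le_iff) auto
      then have "x' \<in> lp_ball (ereal 1) n" using x by (simp add: lp_ball_def cvec_def x'_def)
      then obtain y where y: "y \<in> Y" "\<And>i. cmod (x' i - y i) \<le> C * (?M * real n powr (- 1 / 1))"
        using Y(4) by blast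
      have "cmod (x i - complex_of_real (real n) * y i) \<le> C * (?M * real n powr (- recip p))" for i
      proof -
        have "x i - complex_of_real (real n) * y i = complex_of_real (real n) * (x' i - y i)"
          using nk by (simp add: x'_def right_diff_distrib)
        then have "cmod (x i - complex_of_real (real n) * y i) = real n * cmod (x' i - y i)"
          by (simp add: norm_mult)
        also have "\<dots> \<le> real n * (C * (?M * real n powr (- 1 / 1)))"
          using y by (intro mult_left_mono) auto
        also have "\<dots> = C * (?M * real n powr (- recip p))"
          using nk inf by (simp add: powr_minus field_simps)
        finally show ?thesis .
      qed
      then show ?thesis using y by (auto simp: Z_def)
    qed
    moreover have "finite Z" "Z \<subseteq> cvec n" using Y by (auto simp: Z_def cvec_def)
    moreover have "card Z \<le> 2 ^ (k - 1)" unfolding Z_def using Y card_image_le order_trans by blast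
    ultimately show "\<exists>Y. finite Y \<and> Y \<subseteq> cvec n \<and> card Y \<le> 2 ^ (k - 1) \<and>
        (\<forall>x\<in>lp_ball p n. \<exists>y\<in>Y. \<forall>i. cmod (x i - y i) \<le> C * (?M * real n powr (- recip p)))"
      by blast
  qed
qed

text \<open>Passing from the coordinatewise error to the \<open>q\<close>-norm costs a factor
  \<open>n powr recip q\<close>, whatever the order of \<open>p\<close> and
  \<open>q\<close>.\<close>

lemma entropy_upper_large_k:
  assumes "0 < p" "0 < q"
  obtains C where "0 < C" "\<And>n k. \<lbrakk>1 \<le> n; 2 * n \<le> k\<rbrakk> \<Longrightarrow>
    entropy_id p q n k \<le> C * (2 powr (- (real k - 1) / (2 * real n)) * real n powr (recip q - recip p))"
proof -
  obtain C where C: "0 < C" "\<And>n k. \<lbrakk>1 \<le> n; 2 * n \<le> k\<rbrakk> \<Longrightarrow>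
      \<exists>Y. finite Y \<and> Y \<subseteq> cvec n \<and> card Y \<le> 2 ^ (k - 1) \<and>
        (\<forall>x\<in>lp_ball p n. \<exists>y\<in>Y. \<forall>i.
          cmod (x i - y i) \<le> C * (2 powr (- (real k - 1) / (2 * real n)) * real n powr (- recip p)))"
    by (rule cover_large_k[OF assms(1)]) blast
  show thesis
  proof (rule that[OF C(1)])
    fix n k :: nat assume nk: "1 \<le> n" "2 * n \<le> k"
    let ?M = "2 powr (- (real k - 1) / (2 * real n))"
    let ?r = "C * (?M * real n powr (- recip p))"
    obtain Y where Y: "finite Y" "Y \<subseteq> cvec n" "card Y \<le> 2 ^ (k - 1)"
      "\<And>x. x \<in> lp_ball p n \<Longrightarrow> \<exists>y\<in>Y. \<forall>i. cmod (x i - y i) \<le> ?r"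
      using C(2)[OF nk] by blast
    have r: "0 \<le> ?r" using C(1) by simp
    have eq: "real n powr recip q * ?r = C * (?M * real n powr (recip q - recip p))"
      by (simp only: diff_conv_add_uminus powr_add mult_ac)
    have "entropy_id p q n k \<le> real n powr recip q * ?r"
    proof (rule entropy_id_le[OF _ _ Y(3)])
      show "0 < real n powr recip q * ?r" using C(1) nk by simp
      show "covers p q n Y (real n powr recip q * ?r)"
        unfolding covers_def
      proof (intro conjI ballI Y(1,2))
        fix x assume "x \<in> lp_ball p n"
        then obtain y where y: "y \<in> Y" "\<And>i. cmod (x i - y i) \<le> ?r" using Y(4) by blast
        then have "lp_norm q n (x - y) \<le> real n powr recip q * ?r"
          using assms nk r by (intro lp_norm_le_of_coord) auto
        then show "\<exists>y\<in>Y. lp_norm q n (x - y) \<le> real n powr recip q * ?r" using y by blast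
      qed
    qed
    then show "entropy_id p q n k \<le> C * (?M * real n powr (recip q - recip p))" unfolding eq .
  qed
qed

section \<open>Upper bounds for \<open>p \<le> q\<close>\<close>

lemma lp_norm_le_one_of_le:
  assumes "0 < p" "p \<le> q" "1 \<le> n" "x \<in> lp_ball p n"
  shows "lp_norm q n x \<le> 1"
proof -
  have q: "0 < q" using assms by simp
  note coord = lp_ball_coord[OF assms(1,3,4)]
  from q show ?thesis
  proof (cases rule: ereal_pos_cases)
    case inf
    then show ?thesis using coord assms by (simp add: lp_norm_inf_le_iff)
  next
    case (fin b)
    then obtain a where a: "p = ereal a" "0 < a" "a \<le> b" using assms by (cases p) auto
    have "cmod (x i) powr b \<le> cmod (x i) powr a" if "i < n" for i
      using coord[OF that] a by (intro powr_mono') auto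
    then have "(\<Sum>i<n. cmod (x i) powr b) \<le> (\<Sum>i<n. cmod (x i) powr a)" by (intro sum_mono) auto
    also have "\<dots> \<le> 1" using assms a by (simp add: lp_ball_def lp_norm_le_iff)
    finally show ?thesis using fin by (simp add: lp_norm_le_iff)
  qed
qed

lemma entropy_upper_le_one:
  assumes "0 < p" "p \<le> q" "1 \<le> n"
  shows "entropy_id p q n k \<le> 1"
  using lp_norm_le_one_of_le[OF assms] by (intro entropy_id_le_trivial) auto

text \<open>For finite \<open>q = b\<close>, write the \<open>b\<close>-th power of
  \<open>cmod (v i)\<close> as its \<open>(b - a)\<close>-th power, bounded through
  \<open>R\<close>, times its \<open>a\<close>-th power, bounded through \<open>x\<close>. For
  \<open>q = \<infinity>\<close> the exponent is 1 and the bound is \<open>R\<close> itself.\<close>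

lemma lp_norm_interpolate:
  assumes "0 < a" "ereal a \<le> q" "1 \<le> n" "0 < R" "x \<in> lp_ball (ereal a) n"
    and v: "\<And>i. cmod (v i) \<le> cmod (x i)" "\<And>i. cmod (v i) \<le> R"
  shows "lp_norm q n v \<le> R powr (1 - a * recip q)"
proof -
  have "0 < q" using assms(1,2) by (metis ereal_less(2) less_le_trans)
  then show ?thesis
  proof (cases rule: ereal_pos_cases)
    case inf
    then show ?thesis using assms by (simp add: lp_norm_inf_le_iff)
  next
    case (fin b)
    then have ab: "a \<le> b" using assms by simp
    have "(\<Sum>i<n. cmod (v i) powr b) \<le> (\<Sum>i<n. R powr (b - a) * cmod (x i) powr a)"
    proof (rule sum_mono)
      fix i
      have "cmod (v i) powr b = cmod (v i) powr (b - a) * cmod (v i) powr a"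
        by (simp add: powr_add[symmetric])
      also have "\<dots> \<le> R powr (b - a) * cmod (x i) powr a"
        using ab assms(1) v by (intro mult_mono powr_mono2) auto
      finally show "cmod (v i) powr b \<le> R powr (b - a) * cmod (x i) powr a" .
    qed
    also have "\<dots> = R powr (b - a) * (\<Sum>i<n. cmod (x i) powr a)" by (simp add: sum_distrib_left)
    also have "\<dots> \<le> R powr (b - a) * 1"
      using assms by (intro mult_left_mono) (auto simp: lp_ball_def lp_norm_le_iff)
    also have "\<dots> = (R powr (1 - a * recip q)) powr b"
    proof -
      have "(1 - a * recip q) * b = b - a" using fin by (simp add: left_diff_distrib)
      then show ?thesis by (simp only: powr_powr mult_1_right)
    qed
    finally show ?thesis using fin by (simp add: lp_norm_le_iff)
  qed
qed

text \<open>The centres of \<open>cover_middle_k\<close> give an error that is small in every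
  coordinate and dominated by \<open>x\<close>; interpolation turns the exponent
  \<open>1 / p\<close> into \<open>recip p - recip q\<close>.\<close>

lemma entropy_upper_middle_k:
  assumes "0 < p" "p \<le> q"
  obtains C where "0 < C" "\<And>n k. \<lbrakk>1 \<le> n; 1 \<le> k; log 2 (2 * real n) \<le> real k; k \<le> 2 * n\<rbrakk> \<Longrightarrow>
    entropy_id p q n k \<le> C * (log 2 (1 + 2 * real n / real k) / real k) powr (recip p - recip q)"
proof -
  \<comment> \<open>Positivity of the base matters even when the exponent is \<open>0\<close>,
    because \<open>0 powr 0\<close> is \<open>0\<close> in HOL.\<close>
  have pos: "0 < log 2 (1 + 2 * real n / real k) / real k" if "1 \<le> n" "1 \<le> k" for n k :: nat
  proof -
    have "2 * real n / real k > 0" using that by simp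
    then have "0 < log 2 (1 + 2 * real n / real k)" by (subst zero_less_log_cancel_iff) auto
    then show ?thesis using that by simp
  qed
  from assms(1) show thesis
  proof (cases rule: ereal_pos_cases)
    case inf
    then have "q = \<infinity>" using assms by simp
    show thesis
    proof (rule that[OF zero_less_one])
      fix n k :: nat assume nk: "1 \<le> n" "1 \<le> k"
      have "u powr (recip p - recip q) = 1" if "0 < u" for u using that inf \<open>q = \<infinity>\<close> by simp
      from this[OF pos[OF nk]] show "entropy_id p q n k
        \<le> 1 * (log 2 (1 + 2 * real n / real k) / real k) powr (recip p - recip q)"
        using entropy_upper_le_one[OF assms nk(1), of k] by (simp only: mult_1)
    qed
  next
    case (fin a)
    obtain C where C: "0 < C" "\<And>n k. \<lbrakk>1 \<le> n; 1 \<le> k; log 2 (2 * real n) \<le> real k; k \<le> 2 * n\<rbrakk> \<Longrightarrow>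
      \<exists>Y. finite Y \<and> Y \<subseteq> cvec n \<and> card Y \<le> 2 ^ (k - 1) \<and>
        (\<forall>x\<in>lp_ball (ereal a) n. \<exists>y\<in>Y. \<forall>i. cmod (x i - y i) \<le> cmod (x i) \<and>
          cmod (x i - y i) \<le> C * (log 2 (1 + 2 * real n / real k) / real k) powr (1 / a))"
      by (rule cover_middle_k[OF fin(2)]) blast
    \<comment> \<open>The interpolation exponent, which satisfies
      \<open>1 / a * \<theta> = recip p - recip q\<close>.\<close>
    define \<theta> where "\<theta> = 1 - a * recip q"
    show thesis
    proof (rule that[of "C powr \<theta>"])
      show "0 < C powr \<theta>" using C(1) by simp
      fix n k :: nat
      assume nk: "1 \<le> n" "1 \<le> k" "log 2 (2 * real n) \<le> real k" "k \<le> 2 * n"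
      define u where "u = log 2 (1 + 2 * real n / real k) / real k"
      have u: "0 < u" using pos nk by (simp add: u_def)
      define R where "R = C * u powr (1 / a)"
      have R: "0 < R" using C(1) u by (simp add: R_def)
      have R\<theta>: "R powr \<theta> = C powr \<theta> * u powr (recip p - recip q)"
      proof -
        have "1 / a * \<theta> = recip p - recip q" using fin by (simp add: \<theta>_def field_simps)
        then show ?thesis by (simp only: R_def powr_mult powr_powr)
      qed
      obtain Y where Y: "finite Y" "Y \<subseteq> cvec n" "card Y \<le> 2 ^ (k - 1)"
        "\<And>x. x \<in> lp_ball (ereal a) n \<Longrightarrow> \<exists>y\<in>Y. \<forall>i. cmod (x i - y i) \<le> cmod (x i) \<and> cmod (x i - y i) \<le> R"
        using C(2)[OF nk] unfolding R_def u_def by blast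
      have "entropy_id p q n k \<le> R powr \<theta>"
      proof (rule entropy_id_le[OF _ _ Y(3)])
        show "0 < R powr \<theta>" using R by simp
        show "covers p q n Y (R powr \<theta>)"
          unfolding covers_def
        proof (intro conjI ballI Y(1,2))
          fix x assume "x \<in> lp_ball p n"
          then have x: "x \<in> lp_ball (ereal a) n" using fin by simp
          then obtain y where y: "y \<in> Y" "\<And>i. cmod (x i - y i) \<le> cmod (x i)" "\<And>i. cmod (x i - y i) \<le> R"
            using Y(4) by blast
          then have "lp_norm q n (x - y) \<le> R powr \<theta>"
            unfolding \<theta>_def using fin assms nk R x by (intro lp_norm_interpolate[of a q n R x]) auto
          then show "\<exists>y\<in>Y. lp_norm q n (x - y) \<le> R powr \<theta>" using y by blast
        qed
      qed
      then show "entropy_id p q n k \<le> C powr \<theta> * (log 2 (1 + 2 * real n / real k) / real k) powr (recip p - recip q)"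
        unfolding R\<theta> u_def .
    qed
  qed
qed

section \<open>Upper bounds for \<open>q \<le> p\<close>\<close>

text \<open>For finite exponents, Hoelder's inequality is replaced by
  \<open>u powr b \<le> 1 + u powr a\<close> for \<open>b \<le> a\<close>, applied to
  \<open>u = h * cmod (x i)\<close> with \<open>h powr a = n\<close>. The right-hand sides sum to at
  most \<open>2 * n\<close>, which produces the constant \<open>2 powr (1 / b)\<close>.\<close>

lemma lp_norm_le_of_ge:
  assumes "0 < q" "q \<le> p"
  obtains C where "0 < C"
    "\<And>n x. \<lbrakk>1 \<le> n; x \<in> lp_ball p n\<rbrakk> \<Longrightarrow> lp_norm q n x \<le> C * real n powr (recip q - recip p)"
proof -
  have p: "0 < p" using assms by simp
  from p show thesis
  proof (cases rule: ereal_pos_cases)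
    case inf
    show thesis
    proof (rule that[OF zero_less_one])
      fix n x assume nx: "1 \<le> n" "x \<in> lp_ball p n"
      show "lp_norm q n x \<le> 1 * real n powr (recip q - recip p)"
        using lp_norm_le_of_coord[OF assms(1) nx(1), of 1 x] lp_ball_coord[OF p nx] inf by simp
    qed
  next
    case (fin a)
    then obtain b where b: "q = ereal b" "0 < b" "b \<le> a" using assms by (cases q) auto
    show thesis
    proof (rule that[of "2 powr (1 / b)"])
      fix n x assume nx: "1 \<le> n" "x \<in> lp_ball p n"
      define h where "h = real n powr (1 / a)"
      have h: "h > 0" using nx by (simp add: h_def)
      have ha: "h powr a = real n" using nx fin by (simp add: h_def powr_powr)
      have "(\<Sum>i<n. (h * cmod (x i)) powr b) \<le> (\<Sum>i<n. 1 + (h * cmod (x i)) powr a)"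
      proof (rule sum_mono)
        fix i
        show "(h * cmod (x i)) powr b \<le> 1 + (h * cmod (x i)) powr a"
        proof (cases "h * cmod (x i) \<le> 1")
          case True
          then have "(h * cmod (x i)) powr b \<le> 1 powr b" using h b by (intro powr_mono2) auto
          then show ?thesis by (simp add: add_increasing2)
        next
          case False
          then have "(h * cmod (x i)) powr b \<le> (h * cmod (x i)) powr a" using b by (intro powr_mono) auto
          then show ?thesis by simp
        qed
      qed
      also have "\<dots> = real n + real n * (\<Sum>i<n. cmod (x i) powr a)"
        by (simp add: sum.distrib powr_mult ha sum_distrib_left)
      also have "\<dots> \<le> real n + real n * 1"
        using nx fin by (intro add_left_mono mult_left_mono) (auto simp: lp_ball_def lp_norm_le_iff)
      finally have "h powr b * (\<Sum>i<n. cmod (x i) powr b) \<le> 2 * real n"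
        by (simp add: powr_mult sum_distrib_left)
      then have "(\<Sum>i<n. cmod (x i) powr b) \<le> 2 * real n / h powr b"
        using h by (simp add: field_simps)
      also have "\<dots> = (2 powr (1 / b) * real n powr (recip q - recip p)) powr b"
      proof -
        have "(recip q - recip p) * b = 1 - 1 / a * b" using b fin by (simp add: field_simps)
        then have "(2 powr (1 / b) * real n powr (recip q - recip p)) powr b = 2 * real n powr (1 - 1 / a * b)"
          using b by (simp only: powr_mult powr_powr) simp
        also have "\<dots> = 2 * real n / h powr b" using nx by (simp only: powr_diff h_def powr_powr) simp
        finally show ?thesis by simp
      qed
      finally show "lp_norm q n x \<le> 2 powr (1 / b) * real n powr (recip q - recip p)"
        unfolding b(1) using b(2) by (subst lp_norm_le_iff) auto
    qed simp
  qed
qed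

text \<open>For \<open>k < 2 * n\<close> the norm of the identity is already of the right order,
  since the exponential factor is at least \<open>1 / 2\<close>; from \<open>2 * n\<close> on the
  subdivided covering applies.\<close>

lemma entropy_upper_ge:
  assumes "0 < q" "q \<le> p"
  obtains C where "0 < C" "\<And>n k. \<lbrakk>1 \<le> n; 1 \<le> k\<rbrakk> \<Longrightarrow>
    entropy_id p q n k \<le> C * (2 powr (- (real k - 1) / (2 * real n)) * real n powr (recip q - recip p))"
proof -
  have p: "0 < p" using assms by simp
  obtain C1 where C1: "0 < C1" "\<And>n k. \<lbrakk>1 \<le> n; 2 * n \<le> k\<rbrakk> \<Longrightarrow>
    entropy_id p q n k \<le> C1 * (2 powr (- (real k - 1) / (2 * real n)) * real n powr (recip q - recip p))"
    by (rule entropy_upper_large_k[OF p assms(1)]) blast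
  obtain C2 where C2: "0 < C2"
    "\<And>n x. \<lbrakk>1 \<le> n; x \<in> lp_ball p n\<rbrakk> \<Longrightarrow> lp_norm q n x \<le> C2 * real n powr (recip q - recip p)"
    by (rule lp_norm_le_of_ge[OF assms]) blast
  show thesis
  proof (rule that[of "max C1 (2 * C2)"])
    show "0 < max C1 (2 * C2)" using C1(1) by simp
    fix n k :: nat assume nk: "1 \<le> n" "1 \<le> k"
    let ?M = "2 powr (- (real k - 1) / (2 * real n))"
    let ?N = "real n powr (recip q - recip p)"
    show "entropy_id p q n k \<le> max C1 (2 * C2) * (?M * ?N)"
    proof (cases "2 * n \<le> k")
      case True
      have "entropy_id p q n k \<le> C1 * (?M * ?N)" using C1 nk True by blast
      also have "\<dots> \<le> max C1 (2 * C2) * (?M * ?N)" by (intro mult_right_mono) auto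
      finally show ?thesis .
    next
      case False
      have "entropy_id p q n k \<le> C2 * ?N"
        using C2 nk by (intro entropy_id_le_trivial) auto
      also have "\<dots> = 2 * C2 * (1 / 2 * ?N)" by simp
      also have "\<dots> \<le> max C1 (2 * C2) * (?M * ?N)"
        using two_powr_bounds[OF nk] False C2 by (intro mult_mono) auto
      finally show ?thesis .
    qed
  qed
qed

subsection \<open>Two-sided estimates\<close>

theorem theorem11:
  fixes p q :: ereal
  assumes "0 < p" and "0 < q"
  shows "(p \<le> q \<longrightarrow>
           (\<exists>c C. 0 < c \<and> 0 < C \<and>
             (\<forall>n k. 1 \<le> n \<longrightarrow> 1 \<le> k \<longrightarrow>
               (real k \<le> log 2 (2 * real n) \<longrightarrow>
                  c \<le> entropy_id p q n k \<and> entropy_id p q n k \<le> C) \<and>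
               (log 2 (2 * real n) \<le> real k \<and> k \<le> 2 * n \<longrightarrow>
                  c * (log 2 (1 + 2 * real n / real k) / real k) powr (recip p - recip q)
                    \<le> entropy_id p q n k \<and>
                  entropy_id p q n k
                    \<le> C * (log 2 (1 + 2 * real n / real k) / real k) powr (recip p - recip q)) \<and>
               (2 * n \<le> k \<longrightarrow>
                  c * (2 powr (- (real k - 1) / (2 * real n)) * real n powr (recip q - recip p))
                    \<le> entropy_id p q n k \<and>
                  entropy_id p q n k
                    \<le> C * (2 powr (- (real k - 1) / (2 * real n)) * real n powr (recip q - recip p))))))
       \<and>
       (q \<le> p \<longrightarrow>
           (\<exists>c C. 0 < c \<and> 0 < C \<and>
             (\<forall>n k. 1 \<le> n \<longrightarrow> 1 \<le> k \<longrightarrow>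
                  c * (2 powr (- (real k - 1) / (2 * real n)) * real n powr (recip q - recip p))
                    \<le> entropy_id p q n k \<and>
                  entropy_id p q n k
                    \<le> C * (2 powr (- (real k - 1) / (2 * real n)) * real n powr (recip q - recip p)))))"
proof (intro conjI impI)
  assume le: "p \<le> q"
  obtain c1 where c1: "0 < c1" "\<And>n k. \<lbrakk>1 \<le> n; 1 \<le> k; real k \<le> log 2 (2 * real n)\<rbrakk> \<Longrightarrow> c1 \<le> entropy_id p q n k"
    by (rule entropy_lower_log_k[OF assms le]) blast
  obtain c2 where c2: "0 < c2" "\<And>n k. \<lbrakk>1 \<le> n; 1 \<le> k; log 2 (2 * real n) \<le> real k; k \<le> 2 * n\<rbrakk> \<Longrightarrow>
    c2 * (log 2 (1 + 2 * real n / real k) / real k) powr (recip p - recip q) \<le> entropy_id p q n k"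
    by (rule entropy_lower_middle_k[OF assms le]) blast
  obtain c3 where c3: "0 < c3" "\<And>n k. \<lbrakk>1 \<le> n; 1 \<le> k\<rbrakk> \<Longrightarrow>
    c3 * (2 powr (- (real k - 1) / (2 * real n)) * real n powr (recip q - recip p)) \<le> entropy_id p q n k"
    by (rule entropy_lower_volume[OF assms]) blast
  obtain C2 where C2: "0 < C2" "\<And>n k. \<lbrakk>1 \<le> n; 1 \<le> k; log 2 (2 * real n) \<le> real k; k \<le> 2 * n\<rbrakk> \<Longrightarrow>
    entropy_id p q n k \<le> C2 * (log 2 (1 + 2 * real n / real k) / real k) powr (recip p - recip q)"
    by (rule entropy_upper_middle_k[OF assms(1) le]) blast
  obtain C3 where C3: "0 < C3" "\<And>n k. \<lbrakk>1 \<le> n; 2 * n \<le> k\<rbrakk> \<Longrightarrow>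
    entropy_id p q n k \<le> C3 * (2 powr (- (real k - 1) / (2 * real n)) * real n powr (recip q - recip p))"
    by (rule entropy_upper_large_k[OF assms]) blast
  \<comment> \<open>One pair of constants has to serve all three ranges of \<open>k\<close>. The 1
    in \<open>C\<close> is the trivial upper bound used in the logarithmic range.\<close>
  define c where "c = min c1 (min c2 c3)"
  define C where "C = max 1 (max C2 C3)"
  have c: "0 < c" "c \<le> c1" "c \<le> c2" "c \<le> c3" using c1(1) c2(1) c3(1) by (auto simp: c_def)
  have C: "0 < C" "1 \<le> C" "C2 \<le> C" "C3 \<le> C" by (auto simp: C_def)
  have lo: "c * x \<le> e" if "c' * x \<le> e" "c \<le> c'" "0 \<le> x" for c' x e :: real
    using that mult_right_mono[of c c' x] by linarith
  have up: "e \<le> C * x" if "e \<le> C' * x" "C' \<le> C" "0 \<le> x" for C' x e :: real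
    using that mult_right_mono[of C' C x] by linarith
  have log_k: "c \<le> entropy_id p q n k \<and> entropy_id p q n k \<le> C"
    if "1 \<le> n" "1 \<le> k" "real k \<le> log 2 (2 * real n)" for n k
    using c1(2)[OF that] entropy_upper_le_one[OF assms(1) le that(1), of k] c(2) C(2) by linarith
  have middle_k: "c * (log 2 (1 + 2 * real n / real k) / real k) powr (recip p - recip q) \<le> entropy_id p q n k \<and>
      entropy_id p q n k \<le> C * (log 2 (1 + 2 * real n / real k) / real k) powr (recip p - recip q)"
    if "1 \<le> n" "1 \<le> k" "log 2 (2 * real n) \<le> real k" "k \<le> 2 * n" for n k
    by (intro conjI lo[OF c2(2)[OF that] c(3)] up[OF C2(2)[OF that] C(3)]) simp_all
  have large_k: "c * (2 powr (- (real k - 1) / (2 * real n)) * real n powr (recip q - recip p)) \<le> entropy_id p q n k \<and>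
      entropy_id p q n k \<le> C * (2 powr (- (real k - 1) / (2 * real n)) * real n powr (recip q - recip p))"
    if "1 \<le> n" "1 \<le> k" "2 * n \<le> k" for n k
    by (intro conjI lo[OF c3(2)[OF that(1,2)] c(4)] up[OF C3(2)[OF that(1,3)] C(4)]) simp_all
  show "\<exists>c C. 0 < c \<and> 0 < C \<and>
             (\<forall>n k. 1 \<le> n \<longrightarrow> 1 \<le> k \<longrightarrow>
               (real k \<le> log 2 (2 * real n) \<longrightarrow>
                  c \<le> entropy_id p q n k \<and> entropy_id p q n k \<le> C) \<and>
               (log 2 (2 * real n) \<le> real k \<and> k \<le> 2 * n \<longrightarrow>
                  c * (log 2 (1 + 2 * real n / real k) / real k) powr (recip p - recip q)
                    \<le> entropy_id p q n k \<and>
                  entropy_id p q n k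
                    \<le> C * (log 2 (1 + 2 * real n / real k) / real k) powr (recip p - recip q)) \<and>
               (2 * n \<le> k \<longrightarrow>
                  c * (2 powr (- (real k - 1) / (2 * real n)) * real n powr (recip q - recip p))
                    \<le> entropy_id p q n k \<and>
                  entropy_id p q n k
                    \<le> C * (2 powr (- (real k - 1) / (2 * real n)) * real n powr (recip q - recip p))))"
    by (rule exI[of _ c], rule exI[of _ C], rule conjI[OF c(1)], rule conjI[OF C(1)], intro allI impI conjI;
      (elim conjE)?; rule log_k[THEN conjunct1] log_k[THEN conjunct2] middle_k[THEN conjunct1]
        middle_k[THEN conjunct2] large_k[THEN conjunct1] large_k[THEN conjunct2]; assumption)
next
  assume le: "q \<le> p"
  show "\<exists>c C. 0 < c \<and> 0 < C \<and>
             (\<forall>n k. 1 \<le> n \<longrightarrow> 1 \<le> k \<longrightarrow>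
                  c * (2 powr (- (real k - 1) / (2 * real n)) * real n powr (recip q - recip p))
                    \<le> entropy_id p q n k \<and>
                  entropy_id p q n k
                    \<le> C * (2 powr (- (real k - 1) / (2 * real n)) * real n powr (recip q - recip p)))"
  proof -
    obtain c where c: "0 < c" "\<And>n k. \<lbrakk>1 \<le> n; 1 \<le> k\<rbrakk> \<Longrightarrow>
      c * (2 powr (- (real k - 1) / (2 * real n)) * real n powr (recip q - recip p)) \<le> entropy_id p q n k"
      by (rule entropy_lower_volume[OF assms]) blast
    obtain C where C: "0 < C" "\<And>n k. \<lbrakk>1 \<le> n; 1 \<le> k\<rbrakk> \<Longrightarrow>
      entropy_id p q n k \<le> C * (2 powr (- (real k - 1) / (2 * real n)) * real n powr (recip q - recip p))"
      by (rule entropy_upper_ge[OF assms(2) le]) blast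
    show ?thesis
      by (rule exI[of _ c], rule exI[of _ C], rule conjI[OF c(1)], rule conjI[OF C(1)], intro allI impI conjI;
        rule c(2) C(2); assumption)
  qed
qed

end
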